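(* Fix $\lambda\in(0,\tfrac1{16})$, $\nu=\sqrt{1-16\lambda}$, $t_1=\frac{1-\nu}{4\lambda}$, $t_2=\frac{1+\nu}{4\lambda}$, an integer $l\ge2$, $\ell=(l-1)(l+2)$, $t_i\in(0,t_1)$, and let $G(t)=\tfrac12-\lambda t$, $\alpha(t)=-2t(1-tG(t))$, $\beta(t)=1-2tG(t)$, $\gamma(t)=2G(t)$. Let $\kappa\in[0,\kappa_1)$ with $\kappa_1=\frac{1+32\lambda-32\lambda^2-\nu}{16\lambda}$. Let $f,g,\mu_0\in C_0^\infty(\mathbb{R})$ and let $\phi\in C^\infty([t_i,t_1)\times\mathbb{R})$ be the solution of $$\alpha\phi_{,tt}+2\beta\phi_{,tx}+\gamma\phi_{,xx}+(\alpha'+(6-2\kappa)\beta)\phi_{,t}+(\beta'+(6-2\kappa)\gamma)\phi_{,x}+\big((4-\kappa)\beta'+(8-6\kappa+\kappa^2)\gamma-\ell\big)\phi=8\lambda e^{(\kappa-3)x}\mu_0(te^x)$$ with $\phi(t_i,\cdot)=f$, $\phi_{,t}(t_i,\cdot)=g$. Then $\phi$ is uniformly bounded on $[t_i,t_1)\times\mathbb{R}$: there exist positive constants $C_1,C_2$ (independent of $f,g,\mu_0$) such that $$|\phi(t,x)|^2\le C_1E_1[\phi](0)+C_2J_\kappa[\mu_0],\quad t\in[t_i,t_1),\ x\in\mathbb{R},$$ where $E_1[\phi](0)=\int_{\mathbb{R}}\big(\phi^2+(\alpha\phi_{,t}+\beta\phi_{,x})^2+\phi_{,x}^2\big)\big|_{t=t_i}dx$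 and $J_\kappa[\mu_0]=\int_{\mathbb{R}}e^{2(\kappa-3)x}\mu_0(t_ie^x)^2dx$.
   Context: Primes denote $d/dt$. *)

theory Defs
  imports "HOL-Analysis.Analysis"
begin

text \<open>C^k functions on a set U (meant for open U): continuous for k = 0;
  for k+1: (Frechet) differentiable at every point of U with all first partial
  derivatives (directional derivatives along the standard basis) of class C^k.\<close>
fun Ck_on :: "nat \<Rightarrow> ('a::euclidean_space \<Rightarrow> real) \<Rightarrow> 'a set \<Rightarrow> bool" where
  "Ck_on 0 f U = continuous_on U f"
| "Ck_on (Suc k) f U =
     ((\<forall>p\<in>U. f differentiable (at p)) \<and>
      (\<forall>i\<in>Basis. Ck_on k (\<lambda>p. frechet_derivative f (at p) i) U))"

definition smooth_on :: "('a::euclidean_space \<Rightarrow> real) \<Rightarrow> 'a set \<Rightarrow> bool" where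
  "smooth_on f U \<longleftrightarrow> (\<forall>k. Ck_on k f U)"

definition Cc_infty :: "(real \<Rightarrow> real) \<Rightarrow> bool" where
  "Cc_infty f \<longleftrightarrow> smooth_on f UNIV \<and> compact (closure {x. f x \<noteq> 0})"

definition pd_t :: "(real \<times> real \<Rightarrow> real) \<Rightarrow> real \<times> real \<Rightarrow> real" where
  "pd_t u p = frechet_derivative u (at p) (1, 0)"

definition pd_x :: "(real \<times> real \<Rightarrow> real) \<Rightarrow> real \<times> real \<Rightarrow> real" where
  "pd_x u p = frechet_derivative u (at p) (0, 1)"

definition nu :: "real \<Rightarrow> real" where "nu lam = sqrt (1 - 16 * lam)"
definition t1 :: "real \<Rightarrow> real" where "t1 lam = (1 - nu lam) / (4 * lam)"
definition kappa1 :: "real \<Rightarrow> real" where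
  "kappa1 lam = (1 + 32 * lam - 32 * lam^2 - nu lam) / (16 * lam)"

definition GG :: "real \<Rightarrow> real \<Rightarrow> real" where "GG lam t = 1/2 - lam * t"
definition alpha :: "real \<Rightarrow> real \<Rightarrow> real" where "alpha lam t = - 2 * t * (1 - t * GG lam t)"
definition beta :: "real \<Rightarrow> real \<Rightarrow> real" where "beta lam t = 1 - 2 * t * GG lam t"
definition gamma :: "real \<Rightarrow> real \<Rightarrow> real" where "gamma lam t = 2 * GG lam t"

definition E1_init :: "real \<Rightarrow> real \<Rightarrow> (real \<times> real \<Rightarrow> real) \<Rightarrow> ennreal" where
  "E1_init lam ti u = (\<integral>\<^sup>+ x. ennreal ((u (ti, x))\<^sup>2
       + (alpha lam ti * pd_t u (ti, x) + beta lam ti * pd_x u (ti, x))\<^sup>2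
       + (pd_x u (ti, x))\<^sup>2) \<partial>lborel)"

definition J_kappa :: "real \<Rightarrow> real \<Rightarrow> (real \<Rightarrow> real) \<Rightarrow> ennreal" where
  "J_kappa kappa ti mu0 = (\<integral>\<^sup>+ x. ennreal (exp (2 * (kappa - 3) * x) * (mu0 (ti * exp x))\<^sup>2) \<partial>lborel)"

end

theory Submission
  imports Defs
begin

text \<open>
  Since beta^2 - alpha * gamma = 1, the equation is strictly hyperbolic. Put k = 3 - kappa, which is
  positive because kappa1 < 3, b = G / (1 - t G), and let q be the coefficient of phi and S the
  right-hand side. In the characteristic variables p = alpha phi_t + (beta + 1) phi_x and
  m = alpha phi_t + (beta - 1) phi_x the equation becomes

    p_t = - b p_x - k b p + k m / t - q phi + S,
    m_t = m_x / t - k b p + k m / t - q phi + S,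
    phi_t = - (b p + m / t) / 2,

  where only b is singular: it is of order 1 / tau with tau = t1 - t. As k > 0, the variable p is
  damped at the rate k b, so the energy of tau^(- delta) p^2 + m^2 + phi^2 with a small delta > 0
  absorbs all singular terms in p, and the remaining growth rate is of order tau^(delta - 1), which
  is integrable up to t1. The bound on phi then follows from a one-dimensional Sobolev inequality.
  The energy is localised to backward cones by a cutoff, because phi is not assumed to decay at
  infinity.
\<close>

section \<open>Integral inequalities\<close>

text \<open>Carries the extended-real integrals of the data over to integrals on compact intervals,
  where the energy argument takes place. Nonnegativity makes restriction to an interval only lower
  the value.\<close>

lemma integral_Icc_le_nn_integral:
  fixes f :: "real \<Rightarrow> real"
  assumes "continuous_on UNIV f" "\<And>x. 0 \<le> f x"
    and "(\<integral>\<^sup>+x. ennreal (f x) \<partial>lborel) = ennreal r" "0 \<le> r"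
  shows "integral {a..b} f \<le> r"
proof -
  have "f \<in> borel_measurable borel"
    using assms(1) by (rule borel_measurable_continuous_onI)
  then have f: "(f has_integral r) UNIV"
    using assms by (intro nn_integral_has_integral) auto
  have "f integrable_on {a..b}"
    using assms(1) by (meson continuous_on_subset integrable_continuous_real subset_UNIV)
  then have "integral {a..b} f \<le> integral UNIV f"
    using f assms(2) by (intro integral_subset_le) auto
  with f show ?thesis by (simp add: integral_unique)
qed

text \<open>The weight \<open>x0 + 1 - x\<close> vanishes at the right end point, so integrating the
  derivative of the weighted square leaves only the value at \<open>x0\<close>. As the weight is at
  most 1, the cross term \<open>2 * f * f'\<close> is bounded by the two squares.\<close>

lemma sobolev_interval:
  fixes f f' :: "real \<Rightarrow> real"
  assumes "\<And>x. (f has_real_derivative f' x) (at x)" "continuous_on UNIV f'"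
  shows "(f x0)\<^sup>2 \<le> integral {x0..x0+1} (\<lambda>x. 2 * (f x)\<^sup>2 + (f' x)\<^sup>2)"
proof -
  let ?F = "\<lambda>x. - ((x0 + 1 - x) * (f x)\<^sup>2)"
  let ?F' = "\<lambda>x. (f x)\<^sup>2 - 2 * (x0 + 1 - x) * (f x * f' x)"
  have cf: "continuous_on S f" for S
    using assms(1) by (meson DERIV_isCont continuous_at_imp_continuous_on)
  have cf': "continuous_on S f'" for S
    using assms(2) continuous_on_subset by blast
  have "(?F' has_integral (?F (x0 + 1) - ?F x0)) {x0..x0+1}"
  proof (rule fundamental_theorem_of_calculus)
    fix x
    have "(?F has_real_derivative ?F' x) (at x)"
      by (rule derivative_eq_intros assms refl)+ (auto simp: algebra_simps power2_eq_square)
    then show "(?F has_vector_derivative ?F' x) (at x within {x0..x0+1})"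
      by (simp add: has_real_derivative_iff_has_vector_derivative has_vector_derivative_at_within)
  qed simp
  then have "(?F' has_integral (f x0)\<^sup>2) {x0..x0+1}" by simp
  moreover have "((\<lambda>x. 2 * (f x)\<^sup>2 + (f' x)\<^sup>2) has_integral
      integral {x0..x0+1} (\<lambda>x. 2 * (f x)\<^sup>2 + (f' x)\<^sup>2)) {x0..x0+1}"
    by (intro integrable_integral integrable_continuous_real continuous_intros cf cf')
  ultimately show ?thesis
  proof (rule has_integral_le)
    fix x assume x: "x \<in> {x0..x0+1}"
    have "- (2 * (x0 + 1 - x) * (f x * f' x)) \<le> (x0 + 1 - x) * ((f x)\<^sup>2 + (f' x)\<^sup>2)"
    proof -
      have "0 \<le> (x0 + 1 - x) * (f x + f' x)\<^sup>2" using x by simp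
      then show ?thesis by (simp add: power2_eq_square algebra_simps)
    qed
    also have "\<dots> \<le> 1 * ((f x)\<^sup>2 + (f' x)\<^sup>2)"
      using x by (intro mult_right_mono) auto
    finally show "?F' x \<le> 2 * (f x)\<^sup>2 + (f' x)\<^sup>2" by simp
  qed
qed

lemma continuous_on_slice:
  assumes "continuous_on (S \<times> X) (\<lambda>z. f (fst z) (snd z))" "t \<in> S"
  shows "continuous_on X (f t)"
proof -
  have "continuous_on X (\<lambda>x. (t, x))" by (intro continuous_intros)
  from continuous_on_compose2[OF assms(1) this] assms(2) show ?thesis by auto
qed

text \<open>The flux \<open>F\<close> vanishes at both ends, so \<open>Fx\<close> integrates to zero
  in space and only the source \<open>s\<close> can make the integral of \<open>e\<close>
  grow.\<close>

lemma integral_balance_law_le: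
  fixes e et F Fx s :: "real \<Rightarrow> real \<Rightarrow> real"
  assumes "a \<le> b" "c \<le> d"
    and der_e: "\<And>t x. t \<in> {a..b} \<Longrightarrow> x \<in> {c..d} \<Longrightarrow>
      ((\<lambda>t. e t x) has_real_derivative et t x) (at t within {a..b})"
    and cont_e: "\<And>t. t \<in> {a..b} \<Longrightarrow> continuous_on {c..d} (e t)"
    and cont_et: "continuous_on ({a..b} \<times> {c..d}) (\<lambda>z. et (fst z) (snd z))"
    and der_F: "\<And>t x. t \<in> {a..b} \<Longrightarrow> x \<in> {c..d} \<Longrightarrow> (F t has_real_derivative Fx t x) (at x)"
    and F0: "\<And>t. t \<in> {a..b} \<Longrightarrow> F t c = 0 \<and> F t d = 0"
    and le: "\<And>t x. t \<in> {a..b} \<Longrightarrow> x \<in> {c..d} \<Longrightarrow> et t x \<le> Fx t x + s t x"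
    and cont_s: "\<And>t. t \<in> {a..b} \<Longrightarrow> continuous_on {c..d} (s t)"
    and s: "\<And>t. t \<in> {a..b} \<Longrightarrow> integral {c..d} (s t) \<le> N"
  shows "integral {c..d} (e b) \<le> integral {c..d} (e a) + N * (b - a)"
proof -
  have der: "((\<lambda>t. integral {c..d} (e t)) has_real_derivative integral {c..d} (et t)) (at t within {a..b})"
    if "t \<in> {a..b}" for t
  proof -
    have "((\<lambda>t. integral (cbox c d) (e t)) has_real_derivative integral (cbox c d) (et t))
        (at t within {a..b})"
      using der_e cont_e cont_et that
      by (intro leibniz_rule_field_derivative)
        (auto intro!: integrable_continuous_real simp: split_beta)
    then show ?thesis by simp
  qed
  have bound: "integral {c..d} (et t) \<le> N" if t: "t \<in> {a..b}" for t
  proof -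
    have "continuous_on {c..d} (et t)"
      using cont_et t by (rule continuous_on_slice)
    then have "(et t has_integral integral {c..d} (et t)) {c..d}"
      by (intro integrable_integral integrable_continuous_real)
    moreover have "(Fx t has_integral (F t d - F t c)) {c..d}"
      using \<open>c \<le> d\<close> der_F[OF t]
      by (intro fundamental_theorem_of_calculus)
        (auto simp: has_real_derivative_iff_has_vector_derivative has_vector_derivative_at_within)
    then have "((\<lambda>x. Fx t x + s t x) has_integral (F t d - F t c + integral {c..d} (s t))) {c..d}"
      using cont_s[OF t] by (intro has_integral_add integrable_integral integrable_continuous_real)
    ultimately have "integral {c..d} (et t) \<le> F t d - F t c + integral {c..d} (s t)"
      using le[OF t] by (rule has_integral_le)
    then show ?thesis using F0[OF t] s[OF t] by simp
  qed
  \<comment> \<open>The mean value theorem stands in for an integration in time: the bound on the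
    derivative is uniform, so one intermediate time suffices.\<close>
  obtain t where t: "t \<in> {a..b}"
    "integral {c..d} (e b) - integral {c..d} (e a) = (b - a) * integral {c..d} (et t)"
    using mvt_very_simple[OF \<open>a \<le> b\<close>, of "\<lambda>t. integral {c..d} (e t)" "\<lambda>t h. h * integral {c..d} (et t)"]
      der by (auto simp: has_field_derivative_def mult.commute[of _ "integral _ _"])
  have "(b - a) * integral {c..d} (et t) \<le> (b - a) * N"
    using bound[OF t(1)] \<open>a \<le> b\<close> by (intro mult_left_mono) auto
  with t(2) show ?thesis by (simp add: algebra_simps)
qed

section \<open>A continuously differentiable cutoff function\<close>

text \<open>Squaring the positive part makes the function C^1 across 0, which is the regularity the
  energy weight needs. There is no plateau at 1; the value 1/2 reached at \<open>s = 1\<close>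
  serves as the lower bound.\<close>

definition cutoff :: "real \<Rightarrow> real" where
  "cutoff s = (max 0 s)\<^sup>2 / (1 + (max 0 s)\<^sup>2)"

definition cutoff' :: "real \<Rightarrow> real" where
  "cutoff' s = 2 * max 0 s / (1 + (max 0 s)\<^sup>2)\<^sup>2"

lemma has_real_derivative_positive_part_square:
  "((\<lambda>s::real. (max 0 s)\<^sup>2) has_real_derivative 2 * max 0 s) (at s)"
proof -
  consider "s > 0" | "s < 0" | "s = 0" by linarith
  then show ?thesis
  proof cases
    case 1
    have "((\<lambda>s. s\<^sup>2) has_real_derivative 2 * s) (at s)"
      by (auto intro!: derivative_eq_intros)
    then have "((\<lambda>s. (max 0 s)\<^sup>2) has_real_derivative 2 * s) (at s)"
      by (rule has_field_derivative_transform_within_open[where S = "{0<..}"]) (use 1 in auto)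
    then show ?thesis using 1 by simp
  next
    case 2
    have "((\<lambda>s. 0) has_real_derivative 0) (at s)" by simp
    then have "((\<lambda>s. (max 0 s)\<^sup>2) has_real_derivative 0) (at s)"
      by (rule has_field_derivative_transform_within_open[where S = "{..<0}"]) (use 2 in auto)
    then show ?thesis using 2 by simp
  next
    case 3
    \<comment> \<open>At the corner the difference quotient is \<open>h\<close> or 0 according to
      the sign of \<open>h\<close>, hence dominated by |h|.\<close>
    have "((\<lambda>h. ((max 0 (0 + h))\<^sup>2 - (max 0 0)\<^sup>2) / h) \<longlongrightarrow> 0) (at (0::real))"
    proof (rule Lim_null_comparison)
      show "\<forall>\<^sub>F h in at 0. norm (((max 0 (0 + h))\<^sup>2 - (max 0 0)\<^sup>2) / h) \<le> \<bar>h\<bar>" for h :: real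
        by (rule always_eventually) (auto simp: max_def power2_eq_square)
      show "((\<lambda>h::real. \<bar>h\<bar>) \<longlongrightarrow> 0) (at 0)"
        by (intro tendsto_rabs_zero tendsto_ident_at)
    qed
    then show ?thesis using 3 by (simp add: DERIV_def)
  qed
qed

lemma has_real_derivative_cutoff: "(cutoff has_real_derivative cutoff' s) (at s)"
proof -
  have nz: "1 + (max 0 s)\<^sup>2 \<noteq> 0"
    by (smt (verit) zero_le_power2)
  have "((\<lambda>s. (max 0 s)\<^sup>2 / (1 + (max 0 s)\<^sup>2)) has_real_derivative
      (2 * max 0 s * (1 + (max 0 s)\<^sup>2) - (max 0 s)\<^sup>2 * (0 + 2 * max 0 s)) /
      ((1 + (max 0 s)\<^sup>2) * (1 + (max 0 s)\<^sup>2))) (at s)"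
    by (rule DERIV_divide DERIV_add DERIV_const has_real_derivative_positive_part_square nz)+
  then show ?thesis
    unfolding cutoff_def[abs_def] cutoff'_def
    by (rule DERIV_cong) (simp add: power2_eq_square algebra_simps)
qed

lemma cutoff_nonneg: "0 \<le> cutoff s"
  by (simp add: cutoff_def)

lemma cutoff'_nonneg: "0 \<le> cutoff' s"
  by (simp add: cutoff'_def)

lemma cutoff_le_1: "cutoff s \<le> 1"
  by (simp add: cutoff_def divide_le_eq_1 add_pos_nonneg)

lemma cutoff_eq_0: "s \<le> 0 \<Longrightarrow> cutoff s = 0"
  by (simp add: cutoff_def)

lemma cutoff_ge_half: "1 \<le> s \<Longrightarrow> 1/2 \<le> cutoff s"
proof -
  assume "1 \<le> s"
  then have "1 \<le> s\<^sup>2" by (simp add: one_le_power)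
  moreover have "0 < 1 + s\<^sup>2" by (simp add: add_pos_nonneg)
  ultimately show ?thesis using \<open>1 \<le> s\<close> by (simp add: cutoff_def pos_le_divide_eq)
qed

lemma continuous_on_cutoff: "continuous_on A f \<Longrightarrow> continuous_on A (\<lambda>x. cutoff (f x))"
  using has_real_derivative_cutoff
  by (metis DERIV_isCont continuous_at_imp_continuous_on continuous_on_compose2 subset_UNIV)

lemma continuous_on_cutoff': "continuous_on A f \<Longrightarrow> continuous_on A (\<lambda>x. cutoff' (f x))"
proof -
  have "(1 + (max 0 s)\<^sup>2)\<^sup>2 \<noteq> 0" for s :: real
    by (smt (verit) zero_le_power2 zero_eq_power2)
  then show "continuous_on A f \<Longrightarrow> continuous_on A (\<lambda>x. cutoff' (f x))"
    unfolding cutoff'_def by (intro continuous_intros) auto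
qed

section \<open>The energy estimate for the characteristic system\<close>

text \<open>The damping term \<open>- 2 * k * b * A * p\<^sup>2\<close> pays for everything that
  contains \<open>p\<close>: one half absorbs the growth \<open>A'\<close> of the weight, and a
  quarter of the other half goes to each of the products of \<open>p\<close> with \<open>m\<close>,
  with \<open>u\<close> and with the undamped terms. The right-hand side is then free of
  \<open>p\<close>. Here \<open>c\<close> bounds \<open>A / b\<close> and \<open>B\<close> bounds
  \<open>b / A\<close>.\<close>

lemma zero_order_estimate:
  fixes k b A A' i q p m u s c B I Q :: real
  assumes k: "0 < k" and b: "0 < b" and A: "0 < A" and A': "A' \<le> k * b * A"
    and c: "A \<le> c * b" and B: "b \<le> B * A" and i: "0 \<le> i" "i \<le> I" and q: "\<bar>q\<bar> \<le> Q"
  shows "A' * p\<^sup>2 + 2 * A * p * (k * i * m - q * u + s - k * b * p)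
      + 2 * m * (k * i * m - q * u + s - k * b * p) - u * (b * p + i * m)
    \<le> (1 + I + (4 * c / k + 1) * (3 * (k\<^sup>2 * I\<^sup>2 + Q\<^sup>2)) + (4 * k + 1 / k) * B) * (m\<^sup>2 + u\<^sup>2)
      + 3 * (4 * c / k + 1) * s\<^sup>2"
proof -
  \<comment> \<open>The zero-order terms other than the damping; the singular coefficient
    \<open>b\<close> does not occur in them.\<close>
  define X where "X = k * i * m - q * u + s"
  define K where "K = 3 * (k\<^sup>2 * I\<^sup>2 + Q\<^sup>2)"
  have c0: "0 < c" using c A b by (smt (verit) mult_nonpos_nonneg)
  have B0: "0 < B" using B A b by (smt (verit) mult_nonpos_nonneg)
  have X2: "X\<^sup>2 \<le> K * (m\<^sup>2 + u\<^sup>2) + 3 * s\<^sup>2"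
  proof -
    have "X\<^sup>2 \<le> 3 * ((k * i * m)\<^sup>2 + (q * u)\<^sup>2 + s\<^sup>2)"
    proof -
      have "0 \<le> (k * i * m + q * u)\<^sup>2 + (k * i * m - s)\<^sup>2 + (q * u + s)\<^sup>2" by simp
      then show ?thesis unfolding X_def by (simp add: power2_eq_square algebra_simps)
    qed
    moreover have "(k * i * m)\<^sup>2 \<le> k\<^sup>2 * I\<^sup>2 * m\<^sup>2"
      using i k by (simp add: power_mult_distrib mult_mono power_mono)
    moreover have "(q * u)\<^sup>2 \<le> Q\<^sup>2 * u\<^sup>2"
      using q by (simp add: power_mult_distrib mult_right_mono abs_le_square_iff[symmetric])
    moreover have "0 \<le> Q\<^sup>2 * m\<^sup>2" "0 \<le> k\<^sup>2 * I\<^sup>2 * u\<^sup>2" by simp_all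
    ultimately have "X\<^sup>2 \<le> 3 * (k\<^sup>2 * I\<^sup>2 * m\<^sup>2 + Q\<^sup>2 * u\<^sup>2 + s\<^sup>2) + 3 * (Q\<^sup>2 * m\<^sup>2 + k\<^sup>2 * I\<^sup>2 * u\<^sup>2)"
      by (smt (verit, best))
    then show ?thesis unfolding K_def by (simp add: algebra_simps)
  qed
  have h1: "2 * A * p * X \<le> k / 4 * b * A * p\<^sup>2 + 4 * c / k * X\<^sup>2"
  proof -
    have "0 \<le> A / (k * b) * (k * b / 2 * p - 2 * X)\<^sup>2" using A k b by simp
    also have "\<dots> = k / 4 * b * A * p\<^sup>2 + 4 / k * (A / b) * X\<^sup>2 - 2 * A * p * X"
      using k b by (simp add: power2_eq_square field_simps)
    finally have "2 * A * p * X \<le> k / 4 * b * A * p\<^sup>2 + 4 / k * (A / b) * X\<^sup>2" by simp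
    moreover have "4 / k * (A / b) * X\<^sup>2 \<le> 4 / k * c * X\<^sup>2"
      using c b k by (intro mult_right_mono mult_left_mono) (auto simp: divide_le_eq)
    ultimately show ?thesis by simp
  qed
  \<comment> \<open>These products carry the singular factor \<open>b\<close>. Completing the square
    against the damping replaces it by \<open>b / A\<close>, which is at most
    \<open>B\<close>.\<close>
  have young: "- (b * p * y) \<le> k / 4 * b * A * p\<^sup>2 + B / k * y\<^sup>2" for y
  proof -
    have "0 \<le> b / (k * A) * (k * A / 2 * p + y)\<^sup>2" using b k A by simp
    also have "\<dots> = k / 4 * b * A * p\<^sup>2 + b / A / k * y\<^sup>2 + b * p * y"
      using k A by (simp add: power2_eq_square field_simps)
    finally have "- (b * p * y) \<le> k / 4 * b * A * p\<^sup>2 + b / A / k * y\<^sup>2" by simp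
    moreover have "b / A / k * y\<^sup>2 \<le> B / k * y\<^sup>2"
      using B A k by (intro mult_right_mono divide_right_mono) (auto simp: divide_le_eq)
    ultimately show ?thesis by simp
  qed
  have h2: "- (2 * k * b * p * m) \<le> k / 4 * b * A * p\<^sup>2 + 4 * k * B * m\<^sup>2"
    using young[of "2 * k * m"] k by (simp add: power2_eq_square field_simps)
  have h3: "- (u * b * p) \<le> k / 4 * b * A * p\<^sup>2 + B / k * u\<^sup>2"
    using young[of u] by (simp add: mult.commute mult.left_commute)
  have h4: "2 * m * X \<le> m\<^sup>2 + X\<^sup>2"
    using zero_le_power2[of "m - X"] by (simp add: power2_diff)
  have h5: "- (u * i * m) \<le> I * (m\<^sup>2 + u\<^sup>2)"
  proof -
    have "0 \<le> i / 2 * ((m + u)\<^sup>2 + m\<^sup>2 + u\<^sup>2)" using i by simp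
    then have "- (u * i * m) \<le> i * (m\<^sup>2 + u\<^sup>2)" by (simp add: power2_eq_square algebra_simps)
    also have "\<dots> \<le> I * (m\<^sup>2 + u\<^sup>2)" using i by (intro mult_right_mono) auto
    finally show ?thesis .
  qed
  have h6: "A' * p\<^sup>2 \<le> k * b * A * p\<^sup>2" using A' by (intro mult_right_mono) auto
  have h7: "(4 * c / k + 1) * X\<^sup>2 \<le> (4 * c / k + 1) * (K * (m\<^sup>2 + u\<^sup>2) + 3 * s\<^sup>2)"
    using X2 c0 k by (intro mult_left_mono) auto
  have h8: "0 \<le> k * b * A * p\<^sup>2" using k b A by simp
  \<comment> \<open>The second and third quantities are added to the bound so that \<open>m\<close>
    and \<open>u\<close> receive the same factor \<open>(4 * k + 1 / k) * B\<close>.\<close>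
  have h9: "0 \<le> u\<^sup>2" "0 \<le> 4 * k * B * u\<^sup>2" "0 \<le> B / k * m\<^sup>2" using k B0 by simp_all
  have "A' * p\<^sup>2 + 2 * A * p * (X - k * b * p) + 2 * m * (X - k * b * p) - u * (b * p + i * m)
      = A' * p\<^sup>2 + 2 * A * p * X - 2 * (k * b * A * p\<^sup>2) + 2 * m * X
        + - (2 * k * b * p * m) + - (u * b * p) + - (u * i * m)"
    by (simp add: power2_eq_square algebra_simps)
  also have "\<dots> \<le> m\<^sup>2 + u\<^sup>2 + I * (m\<^sup>2 + u\<^sup>2) + (4 * c / k + 1) * (K * (m\<^sup>2 + u\<^sup>2) + 3 * s\<^sup>2)
      + 4 * k * B * m\<^sup>2 + B / k * u\<^sup>2 + 4 * k * B * u\<^sup>2 + B / k * m\<^sup>2"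
  proof -
    have "(4 * c / k + 1) * X\<^sup>2 = 4 * c / k * X\<^sup>2 + X\<^sup>2" by (simp add: algebra_simps)
    with h1 h2 h3 h4 h5 h6 h7 h8 h9 show ?thesis by linarith
  qed
  also have "\<dots> = (1 + I + (4 * c / k + 1) * K + (4 * k + 1 / k) * B) * (m\<^sup>2 + u\<^sup>2)
      + 3 * (4 * c / k + 1) * s\<^sup>2"
    by (simp add: algebra_simps add_divide_distrib)
  finally show ?thesis unfolding X_def K_def .
qed

text \<open>The balance law is applied to the energy density multiplied by \<open>\<rho>\<close> and
  by a cutoff to a backward cone. The integrating factor \<open>\<rho>\<close> cancels the growth
  rate \<open>N\<close> of \<open>zero_order\<close>. The speed bound \<open>M\<close> fixes the
  slope of the cone but does not enter the final inequality.\<close>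

lemma weighted_energy_estimate:
  fixes p px m mx u s :: "real \<Rightarrow> real \<Rightarrow> real" and b q A A' N \<rho> :: "real \<Rightarrow> real"
  assumes t0: "0 < t0" "t0 \<le> T"
    and p_t: "\<And>t x. t \<in> {t0..T} \<Longrightarrow> ((\<lambda>t. p t x) has_real_derivative
      - b t * px t x + (k * (1 / t) * m t x - q t * u t x + s t x - k * b t * p t x)) (at t within {t0..T})"
    and m_t: "\<And>t x. t \<in> {t0..T} \<Longrightarrow> ((\<lambda>t. m t x) has_real_derivative
      mx t x / t + (k * (1 / t) * m t x - q t * u t x + s t x - k * b t * p t x)) (at t within {t0..T})"
    and u_t: "\<And>t x. t \<in> {t0..T} \<Longrightarrow> ((\<lambda>t. u t x) has_real_derivative
      - (b t * p t x + (1 / t) * m t x) / 2) (at t within {t0..T})"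
    and p_x: "\<And>t x. t \<in> {t0..T} \<Longrightarrow> (p t has_real_derivative px t x) (at x)"
    and m_x: "\<And>t x. t \<in> {t0..T} \<Longrightarrow> (m t has_real_derivative mx t x) (at x)"
    and cont: "continuous_on ({t0..T} \<times> UNIV) (\<lambda>z. p (fst z) (snd z))"
      "continuous_on ({t0..T} \<times> UNIV) (\<lambda>z. px (fst z) (snd z))"
      "continuous_on ({t0..T} \<times> UNIV) (\<lambda>z. m (fst z) (snd z))"
      "continuous_on ({t0..T} \<times> UNIV) (\<lambda>z. mx (fst z) (snd z))"
      "continuous_on ({t0..T} \<times> UNIV) (\<lambda>z. u (fst z) (snd z))"
      "continuous_on ({t0..T} \<times> UNIV) (\<lambda>z. s (fst z) (snd z))"
    and cont_coeff: "continuous_on {t0..T} b" "continuous_on {t0..T} q"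
      "continuous_on {t0..T} A'" "continuous_on {t0..T} N"
    and b: "\<And>t. t \<in> {t0..T} \<Longrightarrow> 0 \<le> b t \<and> b t \<le> M" and M: "1 / t0 \<le> M"
    and A: "\<And>t. t \<in> {t0..T} \<Longrightarrow> (A has_real_derivative A' t) (at t within {t0..T})"
      "\<And>t. t \<in> {t0..T} \<Longrightarrow> 0 \<le> A t"
    and \<rho>: "\<And>t. t \<in> {t0..T} \<Longrightarrow> (\<rho> has_real_derivative - N t * \<rho> t) (at t within {t0..T})"
      "\<And>t. t \<in> {t0..T} \<Longrightarrow> 0 \<le> \<rho> t" "\<And>t. t \<in> {t0..T} \<Longrightarrow> \<rho> t \<le> P"
    and N: "\<And>t. t \<in> {t0..T} \<Longrightarrow> 0 \<le> N t" and D: "0 \<le> D"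
    and zero_order: "\<And>t p m u s. t \<in> {t0..T} \<Longrightarrow>
      A' t * p\<^sup>2 + 2 * A t * p * (k * (1 / t) * m - q t * u + s - k * b t * p)
        + 2 * m * (k * (1 / t) * m - q t * u + s - k * b t * p) - u * (b t * p + (1 / t) * m)
      \<le> N t * (m\<^sup>2 + u\<^sup>2) + D * s\<^sup>2"
    and source: "\<And>t c d. t \<in> {t0..T} \<Longrightarrow> integral {c..d} (\<lambda>x. (s t x)\<^sup>2) \<le> J"
    and init: "\<And>c d. integral {c..d} (\<lambda>x. A t0 * (p t0 x)\<^sup>2 + (m t0 x)\<^sup>2 + (u t0 x)\<^sup>2) \<le> E"
  shows "\<rho> T * integral {x0..x0+1} (\<lambda>x. A T * (p T x)\<^sup>2 + (m T x)\<^sup>2 + (u T x)\<^sup>2)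
    \<le> 4 * (P * E + P * D * J * (T - t0))"
proof -
  \<comment> \<open>At time \<open>T\<close> the cone still has half-width 2, so both cutoff
    arguments are at least 1 on the target interval from \<open>x0\<close> to
    \<open>x0 + 1\<close>.\<close>
  define R where "R = M * (T - t0) + 2"
  define y1 where "y1 = (\<lambda>t x. R - M * (t - t0) - (x - x0))"
  define y2 where "y2 = (\<lambda>t x. R - M * (t - t0) + (x - x0))"
  \<comment> \<open>One factor for each lateral side: \<open>w\<close> is positive exactly where |x
    - x0| < R - M (t - t0).\<close>
  define w where "w = (\<lambda>t x. cutoff (y1 t x) * cutoff (y2 t x))"
  define wt where "wt = (\<lambda>t x. - M * (cutoff' (y1 t x) * cutoff (y2 t x) + cutoff (y1 t x) * cutoff' (y2 t x)))"
  define wx where "wx = (\<lambda>t x. cutoff (y1 t x) * cutoff' (y2 t x) - cutoff' (y1 t x) * cutoff (y2 t x))"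
  define H where "H = (\<lambda>t x. A t * (p t x)\<^sup>2 + (m t x)\<^sup>2 + (u t x)\<^sup>2)"
  define z where "z = (\<lambda>t x. k * (1 / t) * m t x - q t * u t x + s t x - k * b t * p t x)"
  \<comment> \<open>Time derivative of \<open>H\<close> with the evolution equations inserted;
    \<open>z\<close> is the zero-order part common to those of \<open>p\<close> and
    \<open>m\<close>.\<close>
  define Ht where "Ht = (\<lambda>t x. A' t * (p t x)\<^sup>2 + 2 * A t * p t x * (- b t * px t x + z t x)
     + 2 * m t x * (mx t x / t + z t x) - u t x * (b t * p t x + (1 / t) * m t x))"
  define e where "e = (\<lambda>t x. \<rho> t * (w t x * H t x))"
  define et where "et = (\<lambda>t x. - N t * \<rho> t * (w t x * H t x) + \<rho> t * (wt t x * H t x + w t x * Ht t x))"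
  \<comment> \<open>Flux of the energy: \<open>p\<close> travels with velocity \<open>b\<close> and
    \<open>m\<close> with velocity \<open>- 1 / t\<close>, while \<open>u\<close> is not
    transported.\<close>
  define F where "F = (\<lambda>t x. \<rho> t * (w t x * ((m t x)\<^sup>2 / t - b t * A t * (p t x)\<^sup>2)))"
  define Fx where "Fx = (\<lambda>t x. \<rho> t * (wx t x * ((m t x)\<^sup>2 / t - b t * A t * (p t x)\<^sup>2)
     + w t x * (2 * m t x * mx t x / t - 2 * b t * A t * p t x * px t x)))"

  \<comment> \<open>Signs, derivatives and continuity of the weighted densities\<close>
  have M0: "0 < M" using M t0 by (smt (verit) divide_pos_pos)
  have R2: "2 \<le> R" unfolding R_def using M0 t0 by simp
  have w_bounds: "0 \<le> w t x" "w t x \<le> 1" for t x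
    unfolding w_def using cutoff_nonneg cutoff_le_1 by (simp_all add: mult_le_one)
  have H0: "0 \<le> H t x" if "t \<in> {t0..T}" for t x
    unfolding H_def using A(2)[OF that] by simp
  have w_t: "((\<lambda>t. w t x) has_real_derivative wt t x) (at t within {t0..T})" for t x
  proof -
    have "((\<lambda>t. w t x) has_real_derivative wt t x) (at t)"
      unfolding w_def wt_def y1_def y2_def
      by (rule derivative_eq_intros DERIV_chain2[OF has_real_derivative_cutoff] refl)+
        (simp add: algebra_simps)
    then show ?thesis by (rule has_field_derivative_at_within)
  qed
  have w_x: "(w t has_real_derivative wx t x) (at x)" for t x
    unfolding w_def wx_def y1_def y2_def
    by (rule derivative_eq_intros DERIV_chain2[OF has_real_derivative_cutoff] refl)+
        (simp add: algebra_simps)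
  have H_t: "((\<lambda>t. H t x) has_real_derivative Ht t x) (at t within {t0..T})" if t: "t \<in> {t0..T}" for t x
    unfolding H_def
    by (rule derivative_eq_intros p_t[OF t] m_t[OF t] u_t[OF t] A(1)[OF t] refl)+
      (simp add: Ht_def z_def field_simps)
  have contA: "continuous_on {t0..T} A" using A(1) by (rule DERIV_continuous_on)
  have cont\<rho>: "continuous_on {t0..T} \<rho>" using \<rho>(1) by (rule DERIV_continuous_on)
  have cont_fst: "continuous_on ({t0..T} \<times> UNIV) (\<lambda>z::real\<times>real. f (fst z))"
    if "continuous_on {t0..T} f" for f :: "real \<Rightarrow> real"
    by (rule continuous_on_compose2[OF that]) (auto intro: continuous_intros)
  note ci = cont cont_coeff[THEN cont_fst] cont_fst[OF contA] cont_fst[OF cont\<rho>]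
    continuous_on_cutoff continuous_on_cutoff' continuous_on_fst continuous_on_snd continuous_on_id
  have cont_H: "continuous_on ({t0..T} \<times> UNIV) (\<lambda>z. H (fst z) (snd z))"
    unfolding H_def by (intro ci continuous_intros)
  have cont_w: "continuous_on ({t0..T} \<times> UNIV) (\<lambda>z. w (fst z) (snd z))"
    unfolding w_def y1_def y2_def by (intro ci continuous_intros)
  have cont_e: "continuous_on ({t0..T} \<times> UNIV) (\<lambda>z. e (fst z) (snd z))"
    unfolding e_def by (intro ci cont_H cont_w continuous_intros)
  have cont_et: "continuous_on ({t0..T} \<times> UNIV) (\<lambda>z. et (fst z) (snd z))"
    unfolding et_def wt_def Ht_def z_def y1_def y2_def using t0
    by (intro ci cont_H cont_w continuous_intros) auto
  have slice: "continuous_on S (f t)"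
    if "continuous_on ({t0..T} \<times> UNIV) (\<lambda>z. f (fst z) (snd z))" "t \<in> {t0..T}"
    for f :: "real \<Rightarrow> real \<Rightarrow> real" and S t
    using continuous_on_slice[OF that] continuous_on_subset by blast
  have P0: "0 \<le> P" using \<rho>(2,3)[of t0] t0 by auto

  \<comment> \<open>Pointwise energy inequality\<close>
  have pointwise: "et t x \<le> Fx t x + P * D * (s t x)\<^sup>2" if t: "t \<in> {t0..T}" for t x
  proof -
    have it: "0 < 1 / t" "1 / t \<le> M"
      using t t0 by (auto intro!: order_trans[OF _ M] divide_left_mono)
    define c1 where "c1 = cutoff' (y1 t x) * cutoff (y2 t x)"
    define c2 where "c2 = cutoff (y1 t x) * cutoff' (y2 t x)"
    have c: "0 \<le> c1" "0 \<le> c2"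
      unfolding c1_def c2_def by (simp_all add: cutoff_nonneg cutoff'_nonneg)
    have wt_eq: "wt t x = - M * (c1 + c2)" and wx_eq: "wx t x = c2 - c1"
      unfolding wt_def wx_def c1_def c2_def by simp_all
    \<comment> \<open>Along either family of characteristics the weight cannot increase, because the
      cone closes with speed \<open>M\<close>, at least as large as \<open>b\<close> and
      \<open>1 / t\<close>. This is the family with velocity \<open>b\<close>; \<open>s2\<close>
      treats velocity \<open>- 1 / t\<close>.\<close>
    have s1: "wt t x + b t * wx t x \<le> 0"
    proof -
      have "wt t x + b t * wx t x = - ((M + b t) * c1 + (M - b t) * c2)"
        unfolding wt_eq wx_eq by (simp add: algebra_simps)
      moreover have "0 \<le> (M + b t) * c1 + (M - b t) * c2" using b[OF t] c M0 by simp
      ultimately show ?thesis by simp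
    qed
    have s2: "wt t x - wx t x / t \<le> 0"
    proof -
      have "wt t x - wx t x / t = - ((M - 1 / t) * c1 + (M + 1 / t) * c2)"
        unfolding wt_eq wx_eq by (simp add: algebra_simps diff_divide_distrib)
      moreover have "0 \<le> (M - 1 / t) * c1 + (M + 1 / t) * c2" using it c M0 by simp
      ultimately show ?thesis by simp
    qed
    have s3: "wt t x \<le> 0" unfolding wt_eq using c M0 by simp
    define Z where "Z = A' t * (p t x)\<^sup>2 + 2 * A t * p t x * z t x + 2 * m t x * z t x
      - u t x * (b t * p t x + (1 / t) * m t x)"
    have Z: "Z - N t * H t x \<le> D * (s t x)\<^sup>2"
    proof -
      have "Z \<le> N t * ((m t x)\<^sup>2 + (u t x)\<^sup>2) + D * (s t x)\<^sup>2"
        unfolding Z_def z_def by (rule zero_order[OF t])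
      moreover have "0 \<le> N t * (A t * (p t x)\<^sup>2)" using N[OF t] A(2)[OF t] by simp
      ultimately show ?thesis unfolding H_def by (simp add: algebra_simps)
    qed
    \<comment> \<open>The terms with \<open>px\<close> and \<open>mx\<close> cancel between
      \<open>Ht\<close> and \<open>Fx\<close>. What remains are derivatives of the weight along
      characteristics and the zero-order part reduced by \<open>N * H\<close>.\<close>
    have "et t x - Fx t x = \<rho> t * ((wt t x + b t * wx t x) * (A t * (p t x)\<^sup>2)
        + (wt t x - wx t x / t) * (m t x)\<^sup>2 + wt t x * (u t x)\<^sup>2 + w t x * (Z - N t * H t x))"
      unfolding et_def Fx_def Ht_def Z_def H_def
      by (simp add: algebra_simps)
    also have "\<dots> \<le> \<rho> t * (0 + 0 + 0 + D * (s t x)\<^sup>2)"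
    proof (intro mult_left_mono add_mono)
      show "(wt t x + b t * wx t x) * (A t * (p t x)\<^sup>2) \<le> 0"
        using s1 A(2)[OF t] by (simp add: mult_nonpos_nonneg)
      show "(wt t x - wx t x / t) * (m t x)\<^sup>2 \<le> 0" using s2 by (simp add: mult_nonpos_nonneg)
      show "wt t x * (u t x)\<^sup>2 \<le> 0" using s3 by (simp add: mult_nonpos_nonneg)
      have "w t x * (Z - N t * H t x) \<le> w t x * (D * (s t x)\<^sup>2)"
        using Z w_bounds by (intro mult_left_mono) auto
      also have "\<dots> \<le> 1 * (D * (s t x)\<^sup>2)" using w_bounds D by (intro mult_right_mono) auto
      finally show "w t x * (Z - N t * H t x) \<le> D * (s t x)\<^sup>2" by simp
    qed (use \<rho>(2)[OF t] in auto)
    also have "\<dots> \<le> P * (D * (s t x)\<^sup>2)" using \<rho>(3)[OF t] D by (simp add: mult_right_mono)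
    finally show ?thesis by simp
  qed

  \<comment> \<open>Integration over the cone and removal of the weights\<close>
  have "integral {x0-R..x0+R} (e T) \<le> integral {x0-R..x0+R} (e t0) + (P * D * J) * (T - t0)"
  proof (rule integral_balance_law_le[where F = F and Fx = Fx and et = et and s = "\<lambda>t x. P * D * (s t x)\<^sup>2"])
    fix t x assume t: "t \<in> {t0..T}"
    show "((\<lambda>t. e t x) has_real_derivative et t x) (at t within {t0..T})"
      unfolding e_def et_def
      by (rule derivative_eq_intros \<rho>(1)[OF t] w_t H_t[OF t] refl)+ simp
    show "(F t has_real_derivative Fx t x) (at x)"
      unfolding F_def Fx_def
      by (rule derivative_eq_intros p_x[OF t] m_x[OF t] w_x refl | use t t0 in force)+
    show "et t x \<le> Fx t x + P * D * (s t x)\<^sup>2" by (rule pointwise[OF t])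
  next
    fix t assume t: "t \<in> {t0..T}"
    show "continuous_on {x0-R..x0+R} (e t)" using cont_e t by (rule slice)
    \<comment> \<open>At \<open>x0 + R\<close> the argument \<open>y1\<close>, and at
      \<open>x0 - R\<close> the argument \<open>y2\<close>, equals \<open>- M * (t - t0)\<close>,
      which is not positive.\<close>
    show "F t (x0 - R) = 0 \<and> F t (x0 + R) = 0"
      using t M0 by (simp add: F_def w_def y1_def y2_def cutoff_eq_0)
    show "continuous_on {x0-R..x0+R} (\<lambda>x. P * D * (s t x)\<^sup>2)"
      by (intro continuous_intros slice[OF cont(6) t])
    show "integral {x0-R..x0+R} (\<lambda>x. P * D * (s t x)\<^sup>2) \<le> P * D * J"
      using source[OF t] P0 D by (simp add: mult_left_mono)
  next
    show "continuous_on ({t0..T} \<times> {x0-R..x0+R}) (\<lambda>z. et (fst z) (snd z))"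
      by (rule continuous_on_subset[OF cont_et]) auto
  qed (use t0 R2 in auto)
  moreover have "integral {x0-R..x0+R} (e t0) \<le> P * E"
  proof -
    have tt: "t0 \<in> {t0..T}" using t0 by simp
    have "integral {x0-R..x0+R} (e t0) \<le> integral {x0-R..x0+R} (\<lambda>x. P * H t0 x)"
    proof (intro integral_le integrable_continuous_real continuous_intros
        slice[OF cont_e tt] slice[OF cont_H tt])
      fix x
      have "w t0 x * H t0 x \<le> 1 * H t0 x" using w_bounds H0[OF tt] by (intro mult_right_mono) auto
      then show "e t0 x \<le> P * H t0 x"
        unfolding e_def using \<rho>(2,3)[OF tt] w_bounds H0[OF tt] by (intro mult_mono) auto
    qed
    also have "\<dots> = P * integral {x0-R..x0+R} (H t0)" by simp
    also have "\<dots> \<le> P * E"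
      using init[of "x0 - R" "x0 + R"] P0 unfolding H_def by (intro mult_left_mono) auto
    finally show ?thesis .
  qed
  moreover have "\<rho> T * integral {x0..x0+1} (H T) \<le> 4 * integral {x0-R..x0+R} (e T)"
  proof -
    have tt: "T \<in> {t0..T}" using t0 by simp
    have "\<rho> T * integral {x0..x0+1} (H T) = integral {x0..x0+1} (\<lambda>x. \<rho> T * H T x)" by simp
    also have "\<dots> \<le> integral {x0..x0+1} (\<lambda>x. 4 * e T x)"
    proof (intro integral_le integrable_continuous_real continuous_intros
        slice[OF cont_e tt] slice[OF cont_H tt])
      fix x assume x: "x \<in> {x0..x0+1}"
      \<comment> \<open>Both cutoffs are at least 1/2 here, which accounts for the factor 4 in the
        conclusion.\<close>
      have "1/2 * (1/2) \<le> w T x"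
        unfolding w_def y1_def y2_def R_def using x
        by (intro mult_mono cutoff_ge_half cutoff_nonneg) auto
      then have "1 * H T x \<le> (4 * w T x) * H T x"
        using H0[OF tt] by (intro mult_right_mono) auto
      then have "\<rho> T * (1 * H T x) \<le> \<rho> T * ((4 * w T x) * H T x)"
        using \<rho>(2)[OF tt] by (intro mult_left_mono) auto
      then show "\<rho> T * H T x \<le> 4 * e T x" unfolding e_def by simp
    qed
    also have "\<dots> = 4 * integral {x0..x0+1} (e T)" by simp
    also have "integral {x0..x0+1} (e T) \<le> integral {x0-R..x0+R} (e T)"
    proof (intro integral_subset_le integrable_continuous_real slice[OF cont_e tt] ballI)
      fix x
      show "0 \<le> e T x"
        unfolding e_def using \<rho>(2)[OF tt] H0[OF tt] w_bounds by simp
    qed (use R2 in auto)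
    finally show ?thesis by simp
  qed
  ultimately show ?thesis unfolding H_def by simp
qed

section \<open>Partial derivatives\<close>

lemma Ck_on_Suc_pd:
  assumes "Ck_on (Suc k) f U"
  shows "Ck_on k (pd_t f) U" "Ck_on k (pd_x f) U"
proof -
  have *: "\<forall>i\<in>Basis. Ck_on k (\<lambda>p. frechet_derivative f (at p) i) U" using assms by simp
  have "(1, 0) \<in> (Basis :: (real \<times> real) set)" "(0, 1) \<in> (Basis :: (real \<times> real) set)"
    by (simp_all add: Basis_prod_def)
  with * show "Ck_on k (pd_t f) U" "Ck_on k (pd_x f) U"
    unfolding pd_t_def[abs_def] pd_x_def[abs_def] by (blast dest: bspec)+
qed

lemma Ck_on_continuous: "Ck_on k f U \<Longrightarrow> continuous_on U f"
  by (cases k) (auto intro!: continuous_at_imp_continuous_on differentiable_imp_continuous_within)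

text \<open>The Frechet derivative is composed with the embedding of a coordinate line; its
  linearity turns the restriction into multiplication by the partial derivative.\<close>

lemma has_real_derivative_pd:
  assumes "Ck_on (Suc k) f U" "(t, x) \<in> U"
  shows "((\<lambda>t. f (t, x)) has_real_derivative pd_t f (t, x)) (at t)"
    and "((\<lambda>x. f (t, x)) has_real_derivative pd_x f (t, x)) (at x)"
proof -
  let ?D = "frechet_derivative f (at (t, x))"
  have "\<forall>p\<in>U. f differentiable (at p)" using assms(1) by simp
  then have "f differentiable (at (t, x))" using assms(2) by blast
  then have D: "(f has_derivative ?D) (at (t, x))" by (rule frechet_derivative_works[THEN iffD1])
  then have lin: "linear ?D" by (rule has_derivative_linear)
  have "((\<lambda>t. (t, x)) has_derivative (\<lambda>h. (h, 0))) (at t)"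
    by (intro has_derivative_Pair has_derivative_ident has_derivative_const)
  from has_derivative_compose[OF this D]
  have "((\<lambda>t. f (t, x)) has_derivative (\<lambda>h. ?D (h, 0))) (at t)" .
  moreover have "(\<lambda>h. ?D (h, 0)) = (*) (?D (1, 0))"
  proof
    fix h show "?D (h, 0) = ?D (1, 0) * h" using linear_scale[OF lin, of h "(1, 0)"] by simp
  qed
  ultimately show "((\<lambda>t. f (t, x)) has_real_derivative pd_t f (t, x)) (at t)"
    by (simp add: has_field_derivative_def pd_t_def)
  have "((\<lambda>x. (t, x)) has_derivative (\<lambda>h. (0, h))) (at x)"
    by (intro has_derivative_Pair has_derivative_ident has_derivative_const)
  from has_derivative_compose[OF this D]
  have "((\<lambda>x. f (t, x)) has_derivative (\<lambda>h. ?D (0, h))) (at x)" .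
  moreover have "(\<lambda>h. ?D (0, h)) = (*) (?D (0, 1))"
  proof
    fix h show "?D (0, h) = ?D (0, 1) * h" using linear_scale[OF lin, of h "(0, 1)"] by simp
  qed
  ultimately show "((\<lambda>x. f (t, x)) has_real_derivative pd_x f (t, x)) (at x)"
    by (simp add: has_field_derivative_def pd_x_def)
qed

text \<open>Differentiating f(t, x) = f(a, x) + \<open>\<integral>\<close> f_t ds under the integral sign in x and then in t.\<close>

lemma pd_commute:
  assumes "open U" "(t, x) \<in> U" and C2: "Ck_on (Suc (Suc 0)) f U"
  shows "pd_t (pd_x f) (t, x) = pd_x (pd_t f) (t, x)"
proof -
  \<comment> \<open>A closed rectangle around the point inside \<open>U\<close> is needed: the
    integrals run along its segments in the first variable, starting at
    \<open>t - e1\<close>.\<close>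
  obtain S Y where SY: "open S" "open Y" "t \<in> S" "x \<in> Y" "S \<times> Y \<subseteq> U"
    using open_prod_elim[OF assms(1,2)] by (metis mem_Sigma_iff)
  obtain e1 where e1: "0 < e1" "cball t e1 \<subseteq> S" using SY open_contains_cball by blast
  obtain e2 where e2: "0 < e2" "cball x e2 \<subseteq> Y" using SY open_contains_cball by blast
  let ?a = "t - e1" and ?b = "t + e1" and ?V = "{x - e2..x + e2}"
  have box: "(\<tau>, y) \<in> U" if "\<tau> \<in> {?a..?b}" "y \<in> ?V" for \<tau> y
    using that SY(5) e1(2) e2(2) unfolding cball_eq_atLeastAtMost by blast
  have xV: "x \<in> interior ?V" using e2(1) by simp
  note Ct = Ck_on_Suc_pd(1)[OF C2] and Cx = Ck_on_Suc_pd(2)[OF C2]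
  have cont_tx: "continuous_on U (pd_x (pd_t f))"
    using Ck_on_Suc_pd(2)[OF Ct] by simp
  have cont_t: "continuous_on U (pd_t f)" using Ct by (rule Ck_on_continuous)
  have cont_line: "continuous_on {?a..\<tau>} (\<lambda>s. g (s, y))"
    if "continuous_on U g" "y \<in> ?V" "\<tau> \<in> {?a..?b}" for g :: "real \<times> real \<Rightarrow> real" and y \<tau>
    by (rule continuous_on_compose2[OF that(1)]) (use that box in \<open>auto intro!: continuous_intros\<close>)
  have f_int: "f (\<tau>, y) = f (?a, y) + integral {?a..\<tau>} (\<lambda>s. pd_t f (s, y))"
    if "\<tau> \<in> {?a..?b}" "y \<in> ?V" for \<tau> y
  proof -
    have "((\<lambda>s. pd_t f (s, y)) has_integral (f (\<tau>, y) - f (?a, y))) {?a..\<tau>}"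
    proof (rule fundamental_theorem_of_calculus)
      fix s assume "s \<in> {?a..\<tau>}"
      then have "(s, y) \<in> U" using that box by auto
      from has_real_derivative_pd(1)[OF C2 this]
      show "((\<lambda>s. f (s, y)) has_vector_derivative pd_t f (s, y)) (at s within {?a..\<tau>})"
        by (simp add: has_real_derivative_iff_has_vector_derivative has_vector_derivative_at_within)
    qed (use that in auto)
    then show ?thesis by (simp add: integral_unique)
  qed
  have fx_int: "pd_x f (\<tau>, x) = pd_x f (?a, x) + integral {?a..\<tau>} (\<lambda>s. pd_x (pd_t f) (s, x))"
    if \<tau>: "\<tau> \<in> {?a..?b}" for \<tau>
  proof -
    have "((\<lambda>y. integral (cbox ?a \<tau>) (\<lambda>s. pd_t f (s, y))) has_real_derivative
        integral (cbox ?a \<tau>) (\<lambda>s. pd_x (pd_t f) (s, x))) (at x within ?V)"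
    proof (rule leibniz_rule_field_derivative)
      show "((\<lambda>y. pd_t f (s, y)) has_real_derivative pd_x (pd_t f) (s, y)) (at y within ?V)"
        if "y \<in> ?V" "s \<in> cbox ?a \<tau>" for y s
        using that \<tau> box
        by (intro has_field_derivative_at_within[OF has_real_derivative_pd(2)[OF Ct]]) auto
      show "(\<lambda>s. pd_t f (s, y)) integrable_on cbox ?a \<tau>" if "y \<in> ?V" for y
        using cont_line[OF cont_t that \<tau>] by (auto intro: integrable_continuous_real)
      show "continuous_on (?V \<times> cbox ?a \<tau>) (\<lambda>(y, s). pd_x (pd_t f) (s, y))"
        unfolding split_beta
        by (rule continuous_on_compose2[OF cont_tx]) (use \<tau> box in \<open>auto intro!: continuous_intros\<close>)
    qed (use e2 in auto)
    then have "((\<lambda>y. f (?a, y) + integral {?a..\<tau>} (\<lambda>s. pd_t f (s, y))) has_real_derivative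
        pd_x f (?a, x) + integral {?a..\<tau>} (\<lambda>s. pd_x (pd_t f) (s, x))) (at x within ?V)"
      using has_field_derivative_at_within[OF has_real_derivative_pd(2)[OF C2 box[of ?a x]], of ?V] e1 e2
      by (intro derivative_intros) auto
    then have "((\<lambda>y. f (\<tau>, y)) has_real_derivative
        pd_x f (?a, x) + integral {?a..\<tau>} (\<lambda>s. pd_x (pd_t f) (s, x))) (at x within ?V)"
      \<comment> \<open>The two functions agree on all of \<open>?V\<close>, so the radius 1 is
        arbitrary.\<close>
      by (rule has_field_derivative_transform_within[where d = 1]) (use f_int[OF \<tau>, symmetric] e2 in auto)
    then have "((\<lambda>y. f (\<tau>, y)) has_real_derivative
        pd_x f (?a, x) + integral {?a..\<tau>} (\<lambda>s. pd_x (pd_t f) (s, x))) (at x)"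
      by (simp only: at_within_interior[OF xV])
    moreover have "((\<lambda>y. f (\<tau>, y)) has_real_derivative pd_x f (\<tau>, x)) (at x)"
      using has_real_derivative_pd(2)[OF C2 box[OF \<tau>]] e2 by auto
    ultimately show ?thesis by (rule DERIV_unique[symmetric])
  qed
  have "((\<lambda>\<tau>. pd_x f (?a, x) + integral {?a..\<tau>} (\<lambda>s. pd_x (pd_t f) (s, x))) has_real_derivative
      0 + pd_x (pd_t f) (t, x)) (at t within {?a..?b})"
    using integral_has_real_derivative[OF cont_line[OF cont_tx, of x ?b], of t] e1 e2
    by (intro derivative_intros) auto
  then have "((\<lambda>\<tau>. pd_x f (\<tau>, x)) has_real_derivative 0 + pd_x (pd_t f) (t, x)) (at t within {?a..?b})"
    by (rule has_field_derivative_transform_within[where d = 1]) (use fx_int[symmetric] e1 in auto)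
  then have "((\<lambda>\<tau>. pd_x f (\<tau>, x)) has_real_derivative pd_x (pd_t f) (t, x)) (at t)"
    using e1 at_within_interior[of t "{?a..?b}"] by simp
  with has_real_derivative_pd(1)[OF Cx assms(2)] show ?thesis by (rule DERIV_unique)
qed

section \<open>Coefficients of the equation\<close>

lemma has_real_derivative_alpha:
  "(alpha lam has_real_derivative - 2 + 2 * t - 6 * lam * t\<^sup>2) (at t)"
  unfolding alpha_def[abs_def] GG_def
  by (rule derivative_eq_intros refl)+ (simp add: power2_eq_square algebra_simps)

lemma has_real_derivative_beta: "(beta lam has_real_derivative - 1 + 4 * lam * t) (at t)"
  unfolding beta_def[abs_def] GG_def
  by (rule derivative_eq_intros refl)+ (simp add: algebra_simps)

text \<open>The characteristic speed \<open>(beta - 1) / alpha\<close> after cancelling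
  \<open>- 2 * t\<close>. It is singular at \<open>t1\<close>, where the denominator vanishes; the
  other speed \<open>(beta + 1) / alpha\<close> equals \<open>- 1 / t\<close>.\<close>

definition speed :: "real \<Rightarrow> real \<Rightarrow> real" where
  "speed lam t = GG lam t / (1 - t * GG lam t)"

lemma nu_bounds:
  assumes "0 < lam" "lam < 1/16"
  shows "0 < nu lam" "nu lam < 1" "(nu lam)\<^sup>2 = 1 - 16 * lam"
  using assms by (simp_all add: nu_def)

text \<open>As \<open>16 * lam = 1 - nu^2\<close>, the claim reduces to nu^2 < nu + 32 lam^2, which
  holds because \<open>nu\<close> lies strictly between 0 and 1.\<close>

lemma kappa1_less_3:
  assumes "0 < lam" "lam < 1/16"
  shows "kappa1 lam < 3"
proof -
  have "(nu lam)\<^sup>2 < nu lam"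
    using mult_strict_left_mono[OF nu_bounds(2)[OF assms] nu_bounds(1)[OF assms]]
    by (simp add: power2_eq_square)
  moreover have "0 < lam\<^sup>2" using assms by simp
  ultimately have "1 + 32 * lam - 32 * lam\<^sup>2 - nu lam < 48 * lam"
    using nu_bounds(3)[OF assms] by linarith
  then show ?thesis using assms by (simp add: kappa1_def field_simps)
qed

text \<open>The quadratic factors as \<open>1 - t * G = (t1 - t) * Y\<close> with
  \<open>Y = lam * (t2 - t)\<close>, where \<open>t2\<close> is its larger root. From nu/2 < Y \<le>
  G < 1/2 the quotient \<open>G / Y\<close> lies between 1 and \<open>1 / nu\<close>.\<close>

lemma speed_bounds:
  assumes lam: "0 < lam" "lam < 1/16" and t: "0 < t" "t < t1 lam"
  shows "0 < 1 - t * GG lam t" "1 / (t1 lam - t) \<le> speed lam t"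
    "speed lam t \<le> 1 / (nu lam * (t1 lam - t))"
proof -
  note n = nu_bounds[OF lam]
  define Y where "Y = (1 + nu lam) / 4 - lam * t"
  have lt1: "lam * t1 lam = (1 - nu lam) / 4" using lam by (simp add: t1_def)
  then have lt: "lam * t < (1 - nu lam) / 4" using t lam by (metis mult_strict_left_mono)
  have lt0: "0 < lam * t" using lam t by simp
  have "(lam * t1 lam - lam * t) * Y = (1 - (nu lam)\<^sup>2) / 16 - lam * t / 2 + (lam * t)\<^sup>2"
    unfolding lt1 Y_def by (simp add: power2_eq_square field_simps)
  also have "\<dots> = lam * (1 - t * GG lam t)"
    unfolding n(3) GG_def by (simp add: power2_eq_square algebra_simps)
  finally have "lam * (1 - t * GG lam t) = (lam * t1 lam - lam * t) * Y" ..
  then have "lam * (1 - t * GG lam t) = lam * ((t1 lam - t) * Y)" by (simp add: algebra_simps)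
  then have h: "1 - t * GG lam t = (t1 lam - t) * Y" using lam by simp
  have Y: "nu lam / 2 < Y" unfolding Y_def using lt by (simp add: field_simps)
  with n have Y0: "0 < Y" by simp
  show "0 < 1 - t * GG lam t" unfolding h using Y0 t by simp
  have G: "Y \<le> GG lam t" "GG lam t < 1/2" unfolding Y_def GG_def using n lt0 by (auto simp: field_simps)
  have s: "speed lam t = GG lam t / Y / (t1 lam - t)" unfolding speed_def h by simp
  show "1 / (t1 lam - t) \<le> speed lam t"
    unfolding s using G(1) Y0 t by (intro divide_right_mono) auto
  have "nu lam * GG lam t \<le> nu lam * (1/2)" using G n by (intro mult_left_mono) auto
  with Y have "nu lam * GG lam t \<le> Y" by linarith
  then have "GG lam t / Y \<le> 1 / nu lam"
    using Y0 n(1) by (simp add: divide_le_eq le_divide_eq mult.commute)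
  then have "GG lam t / Y / (t1 lam - t) \<le> 1 / nu lam / (t1 lam - t)"
    using t by (intro divide_right_mono) auto
  then show "speed lam t \<le> 1 / (nu lam * (t1 lam - t))" unfolding s by simp
qed

text \<open>Up to sign, \<open>alpha\<close>, \<open>beta - 1\<close>, \<open>beta + 1\<close> and
  \<open>gamma\<close> are twice \<open>t * h\<close>, \<open>t * G\<close>, \<open>h\<close> and
  \<open>G\<close>, where \<open>h = 1 - t * G\<close>. These relations diagonalise the principal
  part of the equation.\<close>

lemma coefficient_identities:
  assumes "0 < t" "0 < 1 - t * GG lam t"
  shows "speed lam t * alpha lam t = beta lam t - 1" "speed lam t * (beta lam t + 1) = gamma lam t"
    "1 / t * alpha lam t = - (beta lam t + 1)" "1 / t * (beta lam t - 1) = - gamma lam t"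
proof -
  define h where "h = 1 - t * GG lam t"
  have "speed lam t = GG lam t / h" "alpha lam t = - 2 * t * h" "beta lam t - 1 = - 2 * t * GG lam t"
    "beta lam t + 1 = 2 * h" "gamma lam t = 2 * GG lam t"
    by (simp_all add: h_def speed_def alpha_def beta_def gamma_def)
  then show "speed lam t * alpha lam t = beta lam t - 1"
    "speed lam t * (beta lam t + 1) = gamma lam t"
    "1 / t * alpha lam t = - (beta lam t + 1)" "1 / t * (beta lam t - 1) = - gamma lam t"
    using assms by (simp_all add: h_def[symmetric])
qed

text \<open>With \<open>\<tau> = t1 - t\<close>, the weight
  \<open>A = \<tau> powr (- \<delta>)\<close> lowers the singularity of \<open>b / A\<close> to
  \<open>\<tau> powr (\<delta> - 1)\<close>, which is integrable. Hence the integrating factor stays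
  between positive constants up to \<open>t1\<close>, and all constants are uniform in time.\<close>

lemma energy_multipliers:
  assumes lam: "0 < lam" "lam < 1/16" and ti: "0 < ti" "ti < t1 lam" and k: "0 < k"
    and q: "\<And>t. t \<in> {ti..<t1 lam} \<Longrightarrow> \<bar>q t\<bar> \<le> Q"
  obtains A A' N \<rho> :: "real \<Rightarrow> real" and D P A0 r0 :: real
  where "0 < D" "0 < P" "0 < A0" "0 < r0"
    "continuous_on {ti..<t1 lam} A'" "continuous_on {ti..<t1 lam} N"
    "\<And>t. t \<in> {ti..<t1 lam} \<Longrightarrow> (A has_real_derivative A' t) (at t)"
    "\<And>t. t \<in> {ti..<t1 lam} \<Longrightarrow> A0 \<le> A t"
    "\<And>t. t \<in> {ti..<t1 lam} \<Longrightarrow> (\<rho> has_real_derivative - N t * \<rho> t) (at t)"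
    "\<And>t. t \<in> {ti..<t1 lam} \<Longrightarrow> r0 \<le> \<rho> t \<and> \<rho> t \<le> P"
    "\<And>t. t \<in> {ti..<t1 lam} \<Longrightarrow> 0 \<le> N t"
    "\<And>t p m u s. t \<in> {ti..<t1 lam} \<Longrightarrow>
      A' t * p\<^sup>2 + 2 * A t * p * (k * (1 / t) * m - q t * u + s - k * speed lam t * p)
        + 2 * m * (k * (1 / t) * m - q t * u + s - k * speed lam t * p)
        - u * (speed lam t * p + (1 / t) * m)
      \<le> N t * (m\<^sup>2 + u\<^sup>2) + D * s\<^sup>2"
proof -
  \<comment> \<open>The bound by \<open>k\<close> lets the damping dominate
    \<open>A' = \<delta> * A / \<tau>\<close>; the bound by 1/2 keeps \<open>1 - \<delta>\<close>
    positive, so that \<open>A / b\<close> is bounded by \<open>c\<close>.\<close>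
  define \<delta> where "\<delta> = min k (1/2)"
  have \<delta>: "0 < \<delta>" "\<delta> \<le> k" "\<delta> \<le> 1/2" using k by (auto simp: \<delta>_def)
  define c where "c = t1 lam powr (1 - \<delta>)"
  \<comment> \<open>\<open>D0\<close> and \<open>D1\<close> are read off from
    \<open>zero_order_estimate\<close> with \<open>I = 1 / ti\<close> and
    \<open>B = \<tau> powr (\<delta> - 1) / nu\<close>.\<close>
  define D0 where "D0 = 1 + 1 / ti + (4 * c / k + 1) * (3 * (k\<^sup>2 * (1 / ti)\<^sup>2 + Q\<^sup>2))"
  define D1 where "D1 = (4 * k + 1 / k) / nu lam"
  define A where "A = (\<lambda>t. (t1 lam - t) powr (- \<delta>))"
  define A' where "A' = (\<lambda>t. \<delta> * (t1 lam - t) powr (- \<delta> - 1))"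
  define N where "N = (\<lambda>t. D0 + D1 * (t1 lam - t) powr (\<delta> - 1))"
  \<comment> \<open>Exponential of a primitive of \<open>- N\<close>.\<close>
  define \<rho> where "\<rho> = (\<lambda>t. exp (- D0 * t + D1 / \<delta> * (t1 lam - t) powr \<delta>))"
  note n = nu_bounds[OF lam]
  have c0: "0 \<le> c" by (simp add: c_def)
  have D0: "0 \<le> D0" unfolding D0_def using ti c0 k by simp
  have D1: "0 \<le> D1" unfolding D1_def using n k by simp
  have powr_cont: "continuous_on {ti..<t1 lam} (\<lambda>t. (t1 lam - t) powr a)" for a
    by (intro continuous_intros) auto
  have powr_der: "((\<lambda>t. (t1 lam - t) powr a) has_real_derivative - a * (t1 lam - t) powr (a - 1)) (at t)"
    if "t < t1 lam" for t a
  proof -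
    have "((\<lambda>t. (t1 lam - t) powr a) has_real_derivative a * (t1 lam - t) powr (a - 1) * (0 - 1)) (at t)"
      by (rule DERIV_chain2[OF has_real_derivative_powr]) (use that in \<open>auto intro!: derivative_eq_intros\<close>)
    then show ?thesis by simp
  qed
  show thesis
  \<comment> \<open>The first four values are \<open>D\<close>, \<open>P\<close>, \<open>A0\<close>
    and \<open>r0\<close>: the last three bound \<open>\<rho>\<close> above, \<open>A\<close> below
    and \<open>\<rho>\<close> below.\<close>
  proof (rule that[of "3 * (4 * c / k + 1)" "exp (D1 / \<delta> * t1 lam powr \<delta>)" "t1 lam powr (- \<delta>)"
        "exp (- D0 * t1 lam)" A' N A \<rho>])
    show "0 < 3 * (4 * c / k + 1)" using c0 k by (simp add: add_nonneg_pos)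
    show "continuous_on {ti..<t1 lam} A'" "continuous_on {ti..<t1 lam} N"
      unfolding A'_def N_def by (intro continuous_intros powr_cont)+
  next
    fix t assume t: "t \<in> {ti..<t1 lam}"
    then have t': "0 < t" "t < t1 lam" using ti by auto
    show "(A has_real_derivative A' t) (at t)"
      using powr_der[of t "- \<delta>"] t' by (simp add: A_def A'_def)
    show A0: "t1 lam powr (- \<delta>) \<le> A t"
      unfolding A_def using t' \<delta> by (intro powr_mono2') auto
    show "(\<rho> has_real_derivative - N t * \<rho> t) (at t)"
    proof -
      have "((\<lambda>t. - D0 * t + D1 / \<delta> * (t1 lam - t) powr \<delta>) has_real_derivative - D0 * 1
          + D1 / \<delta> * (- \<delta> * (t1 lam - t) powr (\<delta> - 1))) (at t)"
        by (intro DERIV_add DERIV_cmult DERIV_ident powr_der t')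
      from DERIV_chain2[OF DERIV_exp this] show ?thesis
        unfolding \<rho>_def N_def by (rule DERIV_cong) (use \<delta> in \<open>simp add: algebra_simps\<close>)
    qed
    have "(t1 lam - t) powr \<delta> \<le> t1 lam powr \<delta>" using t' \<delta> by (intro powr_mono2) auto
    then have "D1 / \<delta> * (t1 lam - t) powr \<delta> \<le> D1 / \<delta> * t1 lam powr \<delta>"
      using D1 \<delta> by (intro mult_left_mono) auto
    moreover have "0 \<le> D1 / \<delta> * (t1 lam - t) powr \<delta>" using D1 \<delta> by simp
    moreover have "0 \<le> D0 * t" "D0 * t \<le> D0 * t1 lam" using D0 t' by (auto intro: mult_left_mono)
    ultimately show "exp (- D0 * t1 lam) \<le> \<rho> t \<and> \<rho> t \<le> exp (D1 / \<delta> * t1 lam powr \<delta>)"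
      unfolding \<rho>_def by simp
    show "0 \<le> N t" unfolding N_def using D0 D1 by simp
    fix p m u s :: real
    define \<tau> where "\<tau> = t1 lam - t"
    have \<tau>: "0 < \<tau>" "\<tau> \<le> t1 lam" using t' by (auto simp: \<tau>_def)
    have b: "1 / \<tau> \<le> speed lam t" "speed lam t \<le> 1 / (nu lam * \<tau>)"
      using speed_bounds[OF lam t'] by (auto simp: \<tau>_def)
    have b0: "0 < speed lam t" using b(1) \<tau> by (smt (verit) divide_pos_pos)
    have "A' t * p\<^sup>2 + 2 * A t * p * (k * (1 / t) * m - q t * u + s - k * speed lam t * p)
        + 2 * m * (k * (1 / t) * m - q t * u + s - k * speed lam t * p)
        - u * (speed lam t * p + (1 / t) * m)
      \<le> (1 + 1 / ti + (4 * c / k + 1) * (3 * (k\<^sup>2 * (1 / ti)\<^sup>2 + Q\<^sup>2))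
          + (4 * k + 1 / k) * (\<tau> powr (\<delta> - 1) / nu lam)) * (m\<^sup>2 + u\<^sup>2)
        + 3 * (4 * c / k + 1) * s\<^sup>2"
    proof (rule zero_order_estimate[OF k b0])
      show "0 < A t" unfolding A_def using t' by simp
      have A'_eq: "A' t = \<delta> * (1 / \<tau>) * A t"
        unfolding A_def A'_def \<tau>_def[symmetric] using \<tau> by (simp add: powr_diff)
      have "\<delta> * (1 / \<tau>) \<le> k * speed lam t"
        using \<delta> b \<tau> by (intro mult_mono) auto
      then show "A' t \<le> k * speed lam t * A t"
        unfolding A'_eq using \<open>0 < A t\<close> by (intro mult_right_mono) auto
      have "A t = \<tau> powr (1 - \<delta>) * (1 / \<tau>)"
        unfolding A_def \<tau>_def[symmetric] using \<tau> by (simp add: powr_diff powr_minus_divide)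
      also have "\<dots> \<le> c * speed lam t"
        unfolding c_def using \<tau> \<delta> b by (intro mult_mono powr_mono2) auto
      finally show "A t \<le> c * speed lam t" .
      have "\<tau> powr (\<delta> - 1) * A t = 1 / \<tau>"
        unfolding A_def \<tau>_def[symmetric] using \<tau> by (simp add: powr_diff powr_minus_divide)
      then have "\<tau> powr (\<delta> - 1) / nu lam * A t = 1 / (nu lam * \<tau>)" by (simp add: field_simps)
      then show "speed lam t \<le> \<tau> powr (\<delta> - 1) / nu lam * A t" using b(2) by simp
      show "0 \<le> 1 / t" "1 / t \<le> 1 / ti" using t ti by (auto intro: divide_left_mono)
      show "\<bar>q t\<bar> \<le> Q" by (rule q[OF t])
    qed
    also have "1 + 1 / ti + (4 * c / k + 1) * (3 * (k\<^sup>2 * (1 / ti)\<^sup>2 + Q\<^sup>2))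
          + (4 * k + 1 / k) * (\<tau> powr (\<delta> - 1) / nu lam) = N t"
      unfolding N_def D0_def D1_def \<tau>_def by simp
    finally show "A' t * p\<^sup>2 + 2 * A t * p * (k * (1 / t) * m - q t * u + s - k * speed lam t * p)
        + 2 * m * (k * (1 / t) * m - q t * u + s - k * speed lam t * p)
        - u * (speed lam t * p + (1 / t) * m)
      \<le> N t * (m\<^sup>2 + u\<^sup>2) + 3 * (4 * c / k + 1) * s\<^sup>2" .
  qed (use ti in auto)
qed

text \<open>Translating \<open>x\<close> by \<open>ln (ti / t)\<close> turns
  \<open>t * exp x\<close> into \<open>ti * exp x\<close>, at the price of the factor
  \<open>(t / ti) powr (2 * (3 - kappa))\<close>.\<close>

lemma nn_integral_source:
  fixes mu0 :: "real \<Rightarrow> real"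
  assumes [measurable]: "mu0 \<in> borel_measurable borel" and "0 < ti" "0 < t"
  shows "(\<integral>\<^sup>+x. ennreal ((a * exp ((kappa - 3) * x) * mu0 (t * exp x))\<^sup>2) \<partial>lborel)
    = ennreal (a\<^sup>2 * exp (2 * (3 - kappa) * ln (t / ti))) * J_kappa kappa ti mu0"
proof -
  define c where "c = ln (ti / t)"
  have c: "t * exp (c + x) = ti * exp x" for x
    using assms by (simp add: c_def exp_add)
  have ln: "ln (t / ti) = - c" using assms by (simp add: c_def ln_div)
  have "(\<integral>\<^sup>+x. ennreal ((a * exp ((kappa - 3) * x) * mu0 (t * exp x))\<^sup>2) \<partial>lborel)
      = (\<integral>\<^sup>+x. ennreal ((a * exp ((kappa - 3) * (c + x)) * mu0 (ti * exp x))\<^sup>2) \<partial>lborel)"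
    using nn_integral_real_affine[of "\<lambda>x. ennreal ((a * exp ((kappa - 3) * x) * mu0 (t * exp x))\<^sup>2)" 1 c]
    by (simp add: c)
  also have "\<dots> = (\<integral>\<^sup>+x. ennreal (a\<^sup>2 * exp (2 * (3 - kappa) * ln (t / ti)))
      * ennreal (exp (2 * (kappa - 3) * x) * (mu0 (ti * exp x))\<^sup>2) \<partial>lborel)"
    by (intro nn_integral_cong)
      (simp add: ln ennreal_mult'[symmetric] power_mult_distrib exp_double[symmetric]
        exp_add[symmetric] algebra_simps)
  also have "\<dots> = ennreal (a\<^sup>2 * exp (2 * (3 - kappa) * ln (t / ti))) * J_kappa kappa ti mu0"
    unfolding J_kappa_def by (rule nn_integral_cmult) simp
  finally show ?thesis .
qed

text \<open>Pure algebra, with the derivatives as independent reals and \<open>p\<close>,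
  \<open>m\<close> the characteristic variables. The relations give
  \<open>b * p = (be - 1) * ft + ga * fx\<close> and
  \<open>i * m = - (be + 1) * ft - ga * fx\<close>. Their sum is \<open>- 2 * ft\<close>, and
  \<open>3 - kappa\<close> times their difference gives the first-order terms of the equation with
  factor \<open>6 - 2 * kappa\<close>.\<close>

lemma characteristic_form:
  fixes al be ga al' be' q b i kappa f ft fx ftt ftx fxx S :: real
  assumes ids: "b * al = be - 1" "b * (be + 1) = ga" "i * al = - (be + 1)" "i * (be - 1) = - ga"
    and pde: "al * ftt + 2 * be * ftx + ga * fxx + (al' + (6 - 2 * kappa) * be) * ft
      + (be' + (6 - 2 * kappa) * ga) * fx + q * f = S"
  shows "al' * ft + al * ftt + (be' * fx + (be + 1) * ftx)
      = - b * (al * ftx + (be + 1) * fxx) + ((3 - kappa) * i * (al * ft + (be - 1) * fx) - q * f + S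
        - (3 - kappa) * b * (al * ft + (be + 1) * fx))"
    "al' * ft + al * ftt + (be' * fx + (be - 1) * ftx)
      = (al * ftx + (be - 1) * fxx) * i + ((3 - kappa) * i * (al * ft + (be - 1) * fx) - q * f + S
        - (3 - kappa) * b * (al * ft + (be + 1) * fx))"
    "ft = - (b * (al * ft + (be + 1) * fx) + i * (al * ft + (be - 1) * fx)) / 2"
proof -
  have p: "b * (al * y + (be + 1) * z) = (be - 1) * y + ga * z" for y z
    using ids(1,2) by (simp add: distrib_left mult.assoc[symmetric])
  have m: "i * (al * y + (be - 1) * z) = - (be + 1) * y - ga * z" for y z
    using ids(3,4) by (simp add: distrib_left mult.assoc[symmetric])
  show "ft = - (b * (al * ft + (be + 1) * fx) + i * (al * ft + (be - 1) * fx)) / 2"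
    unfolding p m by (simp add: algebra_simps)
  have z: "(3 - kappa) * i * (al * ft + (be - 1) * fx) - q * f + S
        - (3 - kappa) * b * (al * ft + (be + 1) * fx)
      = (3 - kappa) * (- (be + 1) * ft - ga * fx) - q * f + S - (3 - kappa) * ((be - 1) * ft + ga * fx)"
    unfolding p[symmetric] m[symmetric] by (simp add: mult.assoc)
  show "al' * ft + al * ftt + (be' * fx + (be + 1) * ftx)
      = - b * (al * ftx + (be + 1) * fxx) + ((3 - kappa) * i * (al * ft + (be - 1) * fx) - q * f + S
        - (3 - kappa) * b * (al * ft + (be + 1) * fx))"
    unfolding z unfolding mult_minus_left p unfolding pde[symmetric] by (simp add: algebra_simps)
  show "al' * ft + al * ftt + (be' * fx + (be - 1) * ftx)
      = (al * ftx + (be - 1) * fxx) * i + ((3 - kappa) * i * (al * ft + (be - 1) * fx) - q * f + S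
        - (3 - kappa) * b * (al * ft + (be + 1) * fx))"
    unfolding z unfolding mult.commute[of "al * ftx + (be - 1) * fxx" i] m unfolding pde[symmetric]
    by (simp add: algebra_simps)
qed

section \<open>The uniform bound\<close>

theorem theorem3:
  fixes lam kappa ti :: real and l :: int
  assumes "0 < lam" and "lam < 1/16"
    and "l \<ge> 2"
    and "0 < ti" and "ti < t1 lam"
    and "0 \<le> kappa" and "kappa < kappa1 lam"
  shows "\<exists>C1 > 0. \<exists>C2 > 0. \<forall>f g mu0 (phi :: real \<times> real \<Rightarrow> real).
    Cc_infty f \<and> Cc_infty g \<and> Cc_infty mu0 \<and>
    (\<exists>U. open U \<and> {ti..<t1 lam} \<times> UNIV \<subseteq> U \<and> smooth_on phi U) \<and>
    (\<forall>t \<in> {ti..<t1 lam}. \<forall>x.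
       alpha lam t * pd_t (pd_t phi) (t, x)
       + 2 * beta lam t * pd_t (pd_x phi) (t, x)
       + gamma lam t * pd_x (pd_x phi) (t, x)
       + (deriv (alpha lam) t + (6 - 2 * kappa) * beta lam t) * pd_t phi (t, x)
       + (deriv (beta lam) t + (6 - 2 * kappa) * gamma lam t) * pd_x phi (t, x)
       + ((4 - kappa) * deriv (beta lam) t + (8 - 6 * kappa + kappa^2) * gamma lam t
          - real_of_int ((l - 1) * (l + 2))) * phi (t, x)
       = 8 * lam * exp ((kappa - 3) * x) * mu0 (t * exp x)) \<and>
    (\<forall>x. phi (ti, x) = f x) \<and> (\<forall>x. pd_t phi (ti, x) = g x)
    \<longrightarrow> (\<forall>t \<in> {ti..<t1 lam}. \<forall>x.
          ennreal ((phi (t, x))\<^sup>2)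
            \<le> ennreal C1 * E1_init lam ti phi + ennreal C2 * J_kappa kappa ti mu0)"
proof -

  \<comment> \<open>Coefficients and constants\<close>
  define k where "k = 3 - kappa"
  have k: "0 < k" using kappa1_less_3[OF assms(1,2)] assms(7) by (simp add: k_def)
  define L where "L = real_of_int ((l - 1) * (l + 2))"
  define q where "q = (\<lambda>t. (4 - kappa) * (- 1 + 4 * lam * t)
    + (8 - 6 * kappa + kappa^2) * gamma lam t - L)"
  have cont_coeff: "continuous_on S (alpha lam)" "continuous_on S (beta lam)" "continuous_on S q" for S
    unfolding alpha_def[abs_def] beta_def[abs_def] gamma_def q_def GG_def
    by (intro continuous_intros)+
  \<comment> \<open>\<open>q\<close> is a polynomial, so its bound extends over the closed interval
    and is uniform up to \<open>t1\<close>.\<close>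
  have "bounded (q ` {ti..t1 lam})"
    by (intro compact_imp_bounded compact_continuous_image cont_coeff) simp
  then obtain Q where "\<forall>t\<in>{ti..t1 lam}. \<bar>q t\<bar> \<le> Q"
    unfolding bounded_iff by auto
  then have Q: "\<And>t. t \<in> {ti..<t1 lam} \<Longrightarrow> \<bar>q t\<bar> \<le> Q" by auto
  obtain A A' N \<rho> :: "real \<Rightarrow> real" and D P A0 r0 :: real
    where pos: "0 < D" "0 < P" "0 < A0" "0 < r0"
    and cont_A': "continuous_on {ti..<t1 lam} A'" and cont_N: "continuous_on {ti..<t1 lam} N"
    and A: "\<And>t. t \<in> {ti..<t1 lam} \<Longrightarrow> (A has_real_derivative A' t) (at t)"
    and A0: "\<And>t. t \<in> {ti..<t1 lam} \<Longrightarrow> A0 \<le> A t"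
    and \<rho>: "\<And>t. t \<in> {ti..<t1 lam} \<Longrightarrow> (\<rho> has_real_derivative - N t * \<rho> t) (at t)"
    and r0: "\<And>t. t \<in> {ti..<t1 lam} \<Longrightarrow> r0 \<le> \<rho> t \<and> \<rho> t \<le> P"
    and N: "\<And>t. t \<in> {ti..<t1 lam} \<Longrightarrow> 0 \<le> N t"
    and zero_order: "\<And>t p m u s. t \<in> {ti..<t1 lam} \<Longrightarrow>
      A' t * p\<^sup>2 + 2 * A t * p * (k * (1 / t) * m - q t * u + s - k * speed lam t * p)
        + 2 * m * (k * (1 / t) * m - q t * u + s - k * speed lam t * p)
        - u * (speed lam t * p + (1 / t) * m)
      \<le> N t * (m\<^sup>2 + u\<^sup>2) + D * s\<^sup>2"
    by (rule energy_multipliers[where q = q, OF assms(1,2,4,5) k Q]) (assumption, rule that)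
  \<comment> \<open>Largest factor in front of \<open>J_kappa\<close> for the source at times before
    \<open>t1\<close>.\<close>
  define KJ where "KJ = (8 * lam)\<^sup>2 * exp (2 * (3 - kappa) * ln (t1 lam / ti))"
  \<comment> \<open>The first factor comes from the Sobolev step, the second from the energy
    inequality after division by the lower bound \<open>r0\<close>.\<close>
  define C where "C = (2 + 1 / A0) * (4 * P / r0)"
  define C1 where "C1 = C * (2 * A ti + 3)"
  define C2 where "C2 = C * (D * KJ * t1 lam)"
  have ti_mem: "ti \<in> {ti..<t1 lam}" using assms by simp
  have t1_pos: "0 < t1 lam" using assms by linarith
  have KJ: "0 < KJ" unfolding KJ_def using assms(1) by simp
  have C: "0 < C" unfolding C_def using pos by (simp add: add_pos_pos)
  have A_ti: "0 < A ti" using A0[OF ti_mem] pos by simp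
  have C1: "0 < C1" unfolding C1_def using C A_ti by simp
  have C2: "0 < C2" unfolding C2_def using C pos KJ t1_pos by simp
  have bound: "(phi (T, x0))\<^sup>2 \<le> C1 * E + C2 * J"
    if mu0: "Cc_infty mu0" and U: "open U" "{ti..<t1 lam} \<times> UNIV \<subseteq> U" "smooth_on phi U"
    and pde: "\<forall>t \<in> {ti..<t1 lam}. \<forall>x.
       alpha lam t * pd_t (pd_t phi) (t, x)
       + 2 * beta lam t * pd_t (pd_x phi) (t, x)
       + gamma lam t * pd_x (pd_x phi) (t, x)
       + (deriv (alpha lam) t + (6 - 2 * kappa) * beta lam t) * pd_t phi (t, x)
       + (deriv (beta lam) t + (6 - 2 * kappa) * gamma lam t) * pd_x phi (t, x)
       + ((4 - kappa) * deriv (beta lam) t + (8 - 6 * kappa + kappa^2) * gamma lam t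
          - real_of_int ((l - 1) * (l + 2))) * phi (t, x)
       = 8 * lam * exp ((kappa - 3) * x) * mu0 (t * exp x)"
    and T: "T \<in> {ti..<t1 lam}"
    and E: "E1_init lam ti phi = ennreal E" "0 \<le> E" and J: "J_kappa kappa ti mu0 = ennreal J" "0 \<le> J"
    for mu0 phi U T x0 E J
  proof -

    \<comment> \<open>Characteristic system of a solution\<close>
    have Ck: "Ck_on (Suc (Suc (Suc 0))) phi U" using U(3) unfolding smooth_on_def by blast
    note Ct = Ck_on_Suc_pd(1)[OF Ck] and Cx = Ck_on_Suc_pd(2)[OF Ck]
    have Ck2: "Ck_on (Suc (Suc 0)) phi U" using U(3) unfolding smooth_on_def by blast
    have mem: "(t, x) \<in> U" if "t \<in> {ti..<t1 lam}" for t x using that U(2) by blast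
    define p where "p = (\<lambda>t x. alpha lam t * pd_t phi (t, x) + (beta lam t + 1) * pd_x phi (t, x))"
    define m where "m = (\<lambda>t x. alpha lam t * pd_t phi (t, x) + (beta lam t - 1) * pd_x phi (t, x))"
    define px where "px = (\<lambda>t x. alpha lam t * pd_t (pd_x phi) (t, x) + (beta lam t + 1) * pd_x (pd_x phi) (t, x))"
    define mx where "mx = (\<lambda>t x. alpha lam t * pd_t (pd_x phi) (t, x) + (beta lam t - 1) * pd_x (pd_x phi) (t, x))"
    define s where "s = (\<lambda>t x. 8 * lam * exp ((kappa - 3) * x) * mu0 (t * exp x))"
    have sub: "{ti..T} \<subseteq> {ti..<t1 lam}" using T by auto
    have strip: "{ti..T} \<times> UNIV \<subseteq> U" using sub U(2) by blast
    have system: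
      "((\<lambda>t. p t x) has_real_derivative - speed lam t * px t x + (k * (1 / t) * m t x
         - q t * phi (t, x) + s t x - k * speed lam t * p t x)) (at t)"
      "((\<lambda>t. m t x) has_real_derivative mx t x / t + (k * (1 / t) * m t x
         - q t * phi (t, x) + s t x - k * speed lam t * p t x)) (at t)"
      "((\<lambda>t. phi (t, x)) has_real_derivative - (speed lam t * p t x + (1 / t) * m t x) / 2) (at t)"
      "(p t has_real_derivative px t x) (at x)" "(m t has_real_derivative mx t x) (at x)"
      if t: "t \<in> {ti..<t1 lam}" for t x
    proof -
      have t': "0 < t" "t < t1 lam" using t assms by auto
      note ids = coefficient_identities[OF t'(1) speed_bounds(1)[OF assms(1,2) t']]
      note da = has_real_derivative_alpha[of lam t] and db = has_real_derivative_beta[of lam t]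
      have pde': "alpha lam t * pd_t (pd_t phi) (t, x) + 2 * beta lam t * pd_t (pd_x phi) (t, x)
          + gamma lam t * pd_x (pd_x phi) (t, x)
          + (- 2 + 2 * t - 6 * lam * t\<^sup>2 + (6 - 2 * kappa) * beta lam t) * pd_t phi (t, x)
          + (- 1 + 4 * lam * t + (6 - 2 * kappa) * gamma lam t) * pd_x phi (t, x)
          + q t * phi (t, x) = s t x"
        using pde[rule_format, OF t, of x]
        unfolding DERIV_imp_deriv[OF da] DERIV_imp_deriv[OF db] q_def s_def L_def .
      have i: "mx t x / t = mx t x * (1 / t)" by simp
      note cf = characteristic_form[OF ids pde', folded k_def]
      note dtt = has_real_derivative_pd(1)[OF Ct mem[OF t], of x]
        and dtx = has_real_derivative_pd(2)[OF Ct mem[OF t], of x]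
        and dxt = has_real_derivative_pd(1)[OF Cx mem[OF t], of x]
        and dxx = has_real_derivative_pd(2)[OF Cx mem[OF t], of x]
      show "((\<lambda>t. p t x) has_real_derivative - speed lam t * px t x + (k * (1 / t) * m t x
         - q t * phi (t, x) + s t x - k * speed lam t * p t x)) (at t)"
        unfolding p_def m_def px_def cf(1)[symmetric]
        by (rule DERIV_cong[OF DERIV_add[OF DERIV_mult[OF da dtt]
              DERIV_mult[OF DERIV_add[OF db DERIV_const] dxt]]]) (simp add: mult.commute)
      show "((\<lambda>t. m t x) has_real_derivative mx t x / t + (k * (1 / t) * m t x
         - q t * phi (t, x) + s t x - k * speed lam t * p t x)) (at t)"
        unfolding i unfolding p_def m_def mx_def cf(2)[symmetric]
        by (rule DERIV_cong[OF DERIV_add[OF DERIV_mult[OF da dtt]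
              DERIV_mult[OF DERIV_diff[OF db DERIV_const] dxt]]]) (simp add: mult.commute)
      show "((\<lambda>t. phi (t, x)) has_real_derivative - (speed lam t * p t x + (1 / t) * m t x) / 2) (at t)"
        unfolding p_def m_def cf(3)[symmetric] by (rule has_real_derivative_pd(1)[OF Ck mem[OF t]])
      \<comment> \<open>Differentiation in \<open>x\<close> produces \<open>pd_x (pd_t phi)\<close>,
        whereas \<open>px\<close> and \<open>mx\<close> contain \<open>pd_t (pd_x phi)\<close>; the
        symmetry of mixed derivatives reconciles them.\<close>
      show "(p t has_real_derivative px t x) (at x)" "(m t has_real_derivative mx t x) (at x)"
        unfolding p_def m_def px_def mx_def pd_commute[OF U(1) mem[OF t] Ck2]
        by (intro DERIV_add DERIV_cmult dtx dxx)+
    qed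

    \<comment> \<open>Continuity, source term and initial energy\<close>
    have c_fst: "continuous_on ({ti..T} \<times> UNIV) (\<lambda>z. h (fst z))"
      if "\<And>S. continuous_on S h" for h :: "real \<Rightarrow> real"
      by (rule continuous_on_compose2[OF that[of UNIV]]) (auto intro: continuous_intros)
    have c_phi: "continuous_on ({ti..T} \<times> UNIV) (\<lambda>z. h (fst z, snd z))"
      if "continuous_on U h" for h :: "real \<times> real \<Rightarrow> real"
      using continuous_on_subset[OF that strip] by simp
    have c_mu0: "continuous_on UNIV mu0"
      using mu0 unfolding Cc_infty_def smooth_on_def by (meson Ck_on_continuous)
    note c_pd = c_phi[OF Ck_on_continuous[OF Ct]] c_phi[OF Ck_on_continuous[OF Cx]]
      c_phi[OF Ck_on_continuous[OF Ck_on_Suc_pd(1)[OF Cx]]]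
      c_phi[OF Ck_on_continuous[OF Ck_on_Suc_pd(2)[OF Cx]]]
      c_fst[OF cont_coeff(1)] c_fst[OF cont_coeff(2)]
    have J_nn: "integral {c..d} (\<lambda>x. (s t x)\<^sup>2) \<le> KJ * J" if "t \<in> {ti..T}" for t c d
    proof -
      have t: "ti \<le> t" "t < t1 lam" "0 < t" using that sub assms by auto
      have "integral {c..d} (\<lambda>x. (s t x)\<^sup>2) \<le> (8 * lam)\<^sup>2 * exp (2 * (3 - kappa) * ln (t / ti)) * J"
      proof (rule integral_Icc_le_nn_integral)
        show "continuous_on UNIV (\<lambda>x. (s t x)\<^sup>2)"
          unfolding s_def by (intro continuous_intros continuous_on_compose2[OF c_mu0]) auto
        show "(\<integral>\<^sup>+x. ennreal ((s t x)\<^sup>2) \<partial>lborel)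
            = ennreal ((8 * lam)\<^sup>2 * exp (2 * (3 - kappa) * ln (t / ti)) * J)"
          unfolding s_def
          using nn_integral_source[OF borel_measurable_continuous_onI[OF c_mu0] assms(4) t(3), of "8 * lam" kappa] J
          by (simp add: ennreal_mult'')
      qed (use J in auto)
      also have "\<dots> \<le> KJ * J"
      proof -
        have "ln (t / ti) \<le> ln (t1 lam / ti)"
          using t assms(4) by (simp add: divide_right_mono)
        then have "2 * (3 - kappa) * ln (t / ti) \<le> 2 * (3 - kappa) * ln (t1 lam / ti)"
          using k by (intro mult_left_mono) (auto simp: k_def)
        then show ?thesis unfolding KJ_def using J by (intro mult_right_mono mult_left_mono) auto
      qed
      finally show ?thesis .
    qed
    have init: "integral {c..d} (\<lambda>x. A ti * (p ti x)\<^sup>2 + (m ti x)\<^sup>2 + (phi (ti, x))\<^sup>2)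
        \<le> (2 * A ti + 3) * E" for c d
    proof -
      let ?v = "\<lambda>x. alpha lam ti * pd_t phi (ti, x) + beta lam ti * pd_x phi (ti, x)"
      have line: "continuous_on S (\<lambda>x. h (ti, x))"
        if "continuous_on U h" for h :: "real \<times> real \<Rightarrow> real" and S
        by (rule continuous_on_compose2[OF that]) (use mem ti_mem in \<open>auto intro!: continuous_intros\<close>)
      note lc = line[OF Ck_on_continuous[OF Ck]] line[OF Ck_on_continuous[OF Ct]]
        line[OF Ck_on_continuous[OF Cx]]
      have "integral {c..d} (\<lambda>x. A ti * (p ti x)\<^sup>2 + (m ti x)\<^sup>2 + (phi (ti, x))\<^sup>2)
          \<le> integral {c..d} (\<lambda>x. (2 * A ti + 3) * ((phi (ti, x))\<^sup>2 + (?v x)\<^sup>2 + (pd_x phi (ti, x))\<^sup>2))"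
      proof (intro integral_le integrable_continuous_real)
        show "continuous_on {c..d} (\<lambda>x. A ti * (p ti x)\<^sup>2 + (m ti x)\<^sup>2 + (phi (ti, x))\<^sup>2)"
          unfolding p_def m_def by (intro continuous_intros lc)
        show "continuous_on {c..d} (\<lambda>x. (2 * A ti + 3) * ((phi (ti, x))\<^sup>2 + (?v x)\<^sup>2 + (pd_x phi (ti, x))\<^sup>2))"
          by (intro continuous_intros lc)
        fix x
        \<comment> \<open>In these variables \<open>p\<close> is the sum and \<open>m\<close> the
          difference, so both squares are at most
          \<open>2 * (v\<^sup>2 + y\<^sup>2)\<close>.\<close>
        define v y where "v = ?v x" and "y = pd_x phi (ti, x)"
        have pm: "p ti x = v + y" "m ti x = v - y"
          unfolding p_def m_def v_def y_def by (simp_all add: algebra_simps)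
        have "A ti * (v + y)\<^sup>2 \<le> A ti * (2 * (v\<^sup>2 + y\<^sup>2))"
          using A_ti zero_le_power2[of "v - y"]
          by (intro mult_left_mono) (auto simp: power2_eq_square algebra_simps)
        moreover have "(v - y)\<^sup>2 \<le> 2 * (v\<^sup>2 + y\<^sup>2)"
          using zero_le_power2[of "v + y"] by (auto simp: power2_eq_square algebra_simps)
        moreover have "0 \<le> A ti * (phi (ti, x))\<^sup>2" "0 \<le> v\<^sup>2" "0 \<le> y\<^sup>2" "0 \<le> (phi (ti, x))\<^sup>2"
          using A_ti by auto
        moreover have "(2 * A ti + 3) * ((phi (ti, x))\<^sup>2 + v\<^sup>2 + y\<^sup>2)
            = 2 * (A ti * (phi (ti, x))\<^sup>2) + A ti * (2 * (v\<^sup>2 + y\<^sup>2)) + 3 * ((phi (ti, x))\<^sup>2 + v\<^sup>2 + y\<^sup>2)"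
          by (simp add: algebra_simps)
        ultimately have "A ti * (v + y)\<^sup>2 + (v - y)\<^sup>2 + (phi (ti, x))\<^sup>2
            \<le> (2 * A ti + 3) * ((phi (ti, x))\<^sup>2 + v\<^sup>2 + y\<^sup>2)"
          by (smt (verit))
        then show "A ti * (p ti x)\<^sup>2 + (m ti x)\<^sup>2 + (phi (ti, x))\<^sup>2
            \<le> (2 * A ti + 3) * ((phi (ti, x))\<^sup>2 + (?v x)\<^sup>2 + (pd_x phi (ti, x))\<^sup>2)"
          unfolding pm v_def y_def .
      qed
      also have "\<dots> = (2 * A ti + 3) * integral {c..d} (\<lambda>x. (phi (ti, x))\<^sup>2 + (?v x)\<^sup>2 + (pd_x phi (ti, x))\<^sup>2)"
        by simp
      also have "\<dots> \<le> (2 * A ti + 3) * E"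
      proof (intro mult_left_mono integral_Icc_le_nn_integral)
        show "continuous_on UNIV (\<lambda>x. (phi (ti, x))\<^sup>2 + (?v x)\<^sup>2 + (pd_x phi (ti, x))\<^sup>2)"
          by (intro continuous_intros lc)
      qed (use E A_ti in \<open>auto simp: E1_init_def\<close>)
      finally show ?thesis .
    qed

    \<comment> \<open>Weighted energy inequality up to time \<open>T\<close>\<close>
    define M where "M = 1 / (nu lam * (t1 lam - T)) + 1 / ti"
    have speed: "0 \<le> speed lam t \<and> speed lam t \<le> M" if "t \<in> {ti..T}" for t
    proof -
      have t: "0 < t" "t < t1 lam" "t \<le> T" "T < t1 lam" using that T assms by auto
      note n = nu_bounds[OF assms(1,2)]
      have "1 / (nu lam * (t1 lam - t)) \<le> 1 / (nu lam * (t1 lam - T))"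
        using t n by (intro divide_left_mono mult_left_mono mult_pos_pos) auto
      moreover have "0 < 1 / ti" using assms by simp
      moreover have "0 < 1 / (t1 lam - t)" using t by simp
      ultimately show ?thesis using speed_bounds(2,3)[OF assms(1,2) t(1,2)] unfolding M_def by linarith
    qed
    have M: "1 / ti \<le> M"
      unfolding M_def using T nu_bounds[OF assms(1,2)] by simp
    have c_speed: "continuous_on {ti..T} (speed lam)"
      unfolding speed_def[abs_def]
    proof (intro continuous_intros ballI)
      show "continuous_on {ti..T} (GG lam)" "continuous_on {ti..T} (GG lam)"
        unfolding GG_def[abs_def] by (intro continuous_intros)+
      show "1 - t * GG lam t \<noteq> 0" if "t \<in> {ti..T}" for t
        using speed_bounds(1)[OF assms(1,2), of t] that T assms by auto
    qed
    \<comment> \<open>\<open>M\<close> blows up as \<open>T\<close> approaches \<open>t1\<close>,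
      but it only sizes the cone; it is absent from the constants here.\<close>
    have energy: "\<rho> T * integral {x0..x0+1} (\<lambda>x. A T * (p T x)\<^sup>2 + (m T x)\<^sup>2 + (phi (T, x))\<^sup>2)
        \<le> 4 * (P * ((2 * A ti + 3) * E) + P * D * (KJ * J) * (T - ti))"
    proof (rule weighted_energy_estimate[where px = px and mx = mx and s = s and b = "speed lam"
          and q = q and A' = A' and N = N and k = k and M = M and u = "\<lambda>t x. phi (t, x)"])
      show "continuous_on ({ti..T} \<times> UNIV) (\<lambda>z. s (fst z) (snd z))"
        unfolding s_def by (intro continuous_intros continuous_on_compose2[OF c_mu0]) auto
      show "continuous_on {ti..T} A'" "continuous_on {ti..T} N"
        using sub cont_A' cont_N continuous_on_subset by blast+
      show "continuous_on ({ti..T} \<times> UNIV) (\<lambda>z. p (fst z) (snd z))"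
        "continuous_on ({ti..T} \<times> UNIV) (\<lambda>z. px (fst z) (snd z))"
        "continuous_on ({ti..T} \<times> UNIV) (\<lambda>z. m (fst z) (snd z))"
        "continuous_on ({ti..T} \<times> UNIV) (\<lambda>z. mx (fst z) (snd z))"
        unfolding p_def px_def m_def mx_def by (intro continuous_intros c_pd)+
      show "continuous_on {ti..T} q" by (rule cont_coeff)
      show "continuous_on {ti..T} (speed lam)" by (rule c_speed)
      show "continuous_on ({ti..T} \<times> UNIV) (\<lambda>z. phi (fst z, snd z))"
        by (rule c_phi[OF Ck_on_continuous[OF Ck]])
    next
      fix t assume "t \<in> {ti..T}"
      then have t: "t \<in> {ti..<t1 lam}" using sub by blast
      show "0 \<le> A t" using A0[OF t] pos by simp
      show "0 \<le> \<rho> t" "\<rho> t \<le> P" using r0[OF t] pos by auto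
      show "0 \<le> N t" by (rule N[OF t])
      show "(A has_real_derivative A' t) (at t within {ti..T})"
        by (rule has_field_derivative_at_within[OF A[OF t]])
      show "(\<rho> has_real_derivative - N t * \<rho> t) (at t within {ti..T})"
        by (rule has_field_derivative_at_within[OF \<rho>[OF t]])
      fix x
      note has_field_derivative_at_within[OF system(1)[OF t], of x "{ti..T}"]
        has_field_derivative_at_within[OF system(2)[OF t], of x "{ti..T}"]
        has_field_derivative_at_within[OF system(3)[OF t], of x "{ti..T}"]
        system(4,5)[OF t, of x]
      then show "((\<lambda>t. p t x) has_real_derivative - speed lam t * px t x + (k * (1 / t) * m t x
          - q t * phi (t, x) + s t x - k * speed lam t * p t x)) (at t within {ti..T})"
        "((\<lambda>t. m t x) has_real_derivative mx t x / t + (k * (1 / t) * m t x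
          - q t * phi (t, x) + s t x - k * speed lam t * p t x)) (at t within {ti..T})"
        "((\<lambda>t. phi (t, x)) has_real_derivative
          - (speed lam t * p t x + (1 / t) * m t x) / 2) (at t within {ti..T})"
        "(p t has_real_derivative px t x) (at x)" "(m t has_real_derivative mx t x) (at x)" .
      fix p m u s :: real
      show "A' t * p\<^sup>2 + 2 * A t * p * (k * (1 / t) * m - q t * u + s - k * speed lam t * p)
          + 2 * m * (k * (1 / t) * m - q t * u + s - k * speed lam t * p)
          - u * (speed lam t * p + (1 / t) * m)
        \<le> N t * (m\<^sup>2 + u\<^sup>2) + D * s\<^sup>2"
        by (rule zero_order[OF t])
    qed (fact | use assms(4) T pos in simp)+

    \<comment> \<open>Pointwise bound from the energy\<close>
    define H where "H = (\<lambda>x. A T * (p T x)\<^sup>2 + (m T x)\<^sup>2 + (phi (T, x))\<^sup>2)"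
    have line: "continuous_on S (\<lambda>x. h (T, x))"
      if "continuous_on U h" for h :: "real \<times> real \<Rightarrow> real" and S
      by (rule continuous_on_compose2[OF that]) (use mem T in \<open>auto intro!: continuous_intros\<close>)
    note lc = line[OF Ck_on_continuous[OF Ck]] line[OF Ck_on_continuous[OF Ct]]
      line[OF Ck_on_continuous[OF Cx]]
    have "(phi (T, x0))\<^sup>2 \<le> integral {x0..x0+1} (\<lambda>x. 2 * (phi (T, x))\<^sup>2 + (pd_x phi (T, x))\<^sup>2)"
      by (rule sobolev_interval) (intro has_real_derivative_pd(2)[OF Ck mem[OF T]] lc)+
    also have "\<dots> \<le> integral {x0..x0+1} (\<lambda>x. (2 + 1 / A0) * H x)"
    proof (intro integral_le integrable_continuous_real)
      show "continuous_on {x0..x0+1} (\<lambda>x. 2 * (phi (T, x))\<^sup>2 + (pd_x phi (T, x))\<^sup>2)"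
        by (intro continuous_intros lc)
      show "continuous_on {x0..x0+1} (\<lambda>x. (2 + 1 / A0) * H x)"
        unfolding H_def p_def m_def by (intro continuous_intros lc)
      fix x
      \<comment> \<open>As \<open>pd_x phi = (p - m) / 2\<close>, its square is at most
        \<open>P2 + M2\<close>; the lower bound \<open>A0\<close> of the weight then recovers
        \<open>P2\<close> from \<open>A T * P2\<close>.\<close>
      define P2 M2 where "P2 = (p T x)\<^sup>2" and "M2 = (m T x)\<^sup>2"
      have "0 \<le> (p T x + m T x)\<^sup>2 + 2 * (P2 + M2)" by (simp add: P2_def M2_def)
      then have "((p T x - m T x) / 2)\<^sup>2 \<le> P2 + M2"
        unfolding P2_def M2_def by (simp add: power2_eq_square field_simps)
      moreover have "(p T x - m T x) / 2 = pd_x phi (T, x)" by (simp add: p_def m_def algebra_simps)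
      ultimately have v: "(pd_x phi (T, x))\<^sup>2 \<le> P2 + M2" by simp
      have nn: "0 \<le> P2" "0 \<le> M2" by (simp_all add: P2_def M2_def)
      have "A0 * P2 \<le> A T * P2" using A0[OF T] nn by (intro mult_right_mono) auto
      then have AP: "P2 \<le> 1 / A0 * (A T * P2)" using pos by (simp add: field_simps)
      moreover have "0 \<le> A T * P2" using A0[OF T] pos nn by simp
      moreover have "0 \<le> 1 / A0 * (M2 + (phi (T, x))\<^sup>2)" using pos nn by simp
      moreover have "(2 + 1 / A0) * (A T * P2 + M2 + (phi (T, x))\<^sup>2)
          = 2 * (A T * P2) + 2 * M2 + 2 * (phi (T, x))\<^sup>2 + 1 / A0 * (A T * P2)
            + 1 / A0 * (M2 + (phi (T, x))\<^sup>2)"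
        by (simp only: distrib_left distrib_right)
      ultimately have "2 * (phi (T, x))\<^sup>2 + (P2 + M2) \<le> (2 + 1 / A0) * (A T * P2 + M2 + (phi (T, x))\<^sup>2)"
        using nn by linarith
      with v show "2 * (phi (T, x))\<^sup>2 + (pd_x phi (T, x))\<^sup>2 \<le> (2 + 1 / A0) * H x"
        unfolding H_def P2_def M2_def by linarith
    qed
    also have "\<dots> = (2 + 1 / A0) * integral {x0..x0+1} H" by simp
    also have "\<dots> \<le> (2 + 1 / A0) * (4 * P / r0 * ((2 * A ti + 3) * E + D * KJ * t1 lam * J))"
    proof (rule mult_left_mono)
      have H0: "0 \<le> integral {x0..x0+1} H"
        by (rule Henstock_Kurzweil_Integration.integral_nonneg[OF integrable_continuous_real])
          (use A0[OF T] pos in \<open>auto simp: H_def p_def m_def intro!: continuous_intros lc\<close>)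
      have "r0 * integral {x0..x0+1} H \<le> \<rho> T * integral {x0..x0+1} H"
        using r0[OF T] H0 by (intro mult_right_mono) auto
      also have "\<dots> \<le> 4 * (P * ((2 * A ti + 3) * E) + P * D * (KJ * J) * (T - ti))"
        using energy unfolding H_def .
      \<comment> \<open>Replacing the elapsed time by \<open>t1 lam\<close> makes the constant
        independent of \<open>T\<close>.\<close>
      also have "\<dots> \<le> 4 * (P * ((2 * A ti + 3) * E) + P * D * (KJ * J) * t1 lam)"
        using pos KJ J assms(4) T by (intro mult_left_mono add_left_mono) auto
      finally show "integral {x0..x0+1} H \<le> 4 * P / r0 * ((2 * A ti + 3) * E + D * KJ * t1 lam * J)"
        using pos by (simp add: field_simps)
    qed (use pos in auto)
    also have "\<dots> = C1 * E + C2 * J" unfolding C1_def C2_def C_def by (simp add: algebra_simps add_divide_distrib)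
    finally show ?thesis .
  qed

  \<comment> \<open>Passage to extended-real integrals\<close>
  show ?thesis
  proof (intro exI conjI allI impI ballI, rule C1, rule C2, elim conjE exE)
    fix f g mu0 and phi :: "real \<times> real \<Rightarrow> real" and T x0 U
    assume hyps: "Cc_infty mu0" "open U" "{ti..<t1 lam} \<times> UNIV \<subseteq> U" "smooth_on phi U"
      "\<forall>t \<in> {ti..<t1 lam}. \<forall>x.
       alpha lam t * pd_t (pd_t phi) (t, x)
       + 2 * beta lam t * pd_t (pd_x phi) (t, x)
       + gamma lam t * pd_x (pd_x phi) (t, x)
       + (deriv (alpha lam) t + (6 - 2 * kappa) * beta lam t) * pd_t phi (t, x)
       + (deriv (beta lam) t + (6 - 2 * kappa) * gamma lam t) * pd_x phi (t, x)
       + ((4 - kappa) * deriv (beta lam) t + (8 - 6 * kappa + kappa^2) * gamma lam t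
          - real_of_int ((l - 1) * (l + 2))) * phi (t, x)
       = 8 * lam * exp ((kappa - 3) * x) * mu0 (t * exp x)"
      "T \<in> {ti..<t1 lam}"
    show "ennreal ((phi (T, x0))\<^sup>2)
        \<le> ennreal C1 * E1_init lam ti phi + ennreal C2 * J_kappa kappa ti mu0"
    proof (cases "E1_init lam ti phi = top \<or> J_kappa kappa ti mu0 = top")
      case True
      \<comment> \<open>Both constants are positive, so one infinite integral makes the right-hand
        side infinite.\<close>
      then have "ennreal C1 * E1_init lam ti phi + ennreal C2 * J_kappa kappa ti mu0 = top"
        using C1 C2 by (auto simp: ennreal_mult_top)
      then show ?thesis by (simp only: top_greatest)
    next
      case False
      obtain E where E: "E1_init lam ti phi = ennreal E" "0 \<le> E"
        using False by (cases "E1_init lam ti phi" rule: ennreal_cases) auto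
      obtain J where J: "J_kappa kappa ti mu0 = ennreal J" "0 \<le> J"
        using False by (cases "J_kappa kappa ti mu0" rule: ennreal_cases) auto
      have "ennreal ((phi (T, x0))\<^sup>2) \<le> ennreal (C1 * E + C2 * J)"
        by (intro ennreal_leI bound[OF hyps E J])
      also have "\<dots> = ennreal C1 * ennreal E + ennreal C2 * ennreal J"
        using C1 C2 E J by (simp add: ennreal_mult)
      finally show ?thesis unfolding E J .
    qed
  qed
qed

end
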